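(* The following equality of sets holds (identifying functions with their $V$-a.e. equivalence classes): $$H^{\infty}_{W,V}(\mathbb{T}):=\bigcap_{k=1}^{\infty}H^{k}_{W,V}(\mathbb{T})=C^\infty_{W,V}(\mathbb{T}).$$
   Context: $W,V:\mathbb{R}\to\mathbb{R}$ are strictly increasing, $W$ càdlàg, $V$ càglàd, $W(x+1)-W(x)=W(1)-W(0)$ and $V(x+1)-V(x)=V(1)-V(0)$ for all $x$, both are continuous at $0$ and $W(0)=V(0)=0$. $\mathbb{T}=\mathbb{R}/\mathbb{Z}$; $dW((a,b])=W(b)-W(a)$, $dV([a,b))=V(b)-V(a)$; $L^2_V(\mathbb{T}),L^2_W(\mathbb{T})$ are the corresponding $L^2$ spaces. Strong one-sided derivatives: $D^{-}_{W}f(x)=\lim_{h\to0^-}\frac{f(x+h)-f(x)}{W(x+h)-W(x)}$, $D^{+}_{V}g(x)=\lim_{h\to0^+}\frac{g(x+h)-g(x)}{V(x+h)-V(x)}$. $D^{(n)}_{W,V}$ is the alternating composition of $n$ derivatives with $D^-_W$ applied first ($D^-_W$, $D^+_VD^-_W$, $D^-_WD^+_VD^-_W$, ...). $C_0(\mathbb{T})$: càdlàg $f:\mathbb{T}\to\mathbb{R}$ with $\int f\,dV=0$; $C_1(\mathbb{T})$: càglàd $f:\mathbb{T}\to\mathbb{R}$ with $\int f\,dW=0$. $C^\infty_{W,V}(\mathbb{T})$ is the direct sum of the constants and the set of $f\in C_0(\mathbb{T})$ such that for all $n\ge1$ $D^{(n)}_{W,V}f$ exists everywhere and lies in $C_1(\mathbb{T})$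 ($n$ odd) or $C_0(\mathbb{T})$ ($n$ even). $C^\infty_{V,W}(\mathbb{T})$ is the analogue with roles exchanged: constants plus $g\in C_1(\mathbb{T})$ whose alternating derivatives $D^+_Vg\in C_0(\mathbb{T})$, $D^-_WD^+_Vg\in C_1(\mathbb{T})$, ... all exist. Weak derivatives: $f\in L^2_V(\mathbb{T})$ has weak derivative $D^-_Wf=F\in L^2_W(\mathbb{T})$ if $\int_{\mathbb{T}}f\,D^+_Vg\,dV=-\int_{\mathbb{T}}Fg\,dW$ for all $g\in C^\infty_{V,W}(\mathbb{T})$; $h\in L^2_W(\mathbb{T})$ has weak derivative $D^+_Vh=H\in L^2_V(\mathbb{T})$ if $\int_{\mathbb{T}}h\,D^-_Wg\,dW=-\int_{\mathbb{T}}Hg\,dV$ for all $g\in C^\infty_{W,V}(\mathbb{T})$. $H^k_{W,V}(\mathbb{T})$ is the set of $f\in L^2_V(\mathbb{T})$ for which the weak $D^{(n)}_{W,V}f$ exists in $L^2_{\kappa(n)}(\mathbb{T})$ for $n=1,\dots,k$, with $\kappa(n)=W$ for $n$ odd and $V$ for $n$ even. *)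

theory Defs
  imports "HOL-Analysis.Analysis"
begin

text \<open>
  Functions on the torus \<open>\<real>/\<int>\<close> are represented by 1-periodic functions on the real line.
\<close>

definition periodic1 :: "(real \<Rightarrow> real) \<Rightarrow> bool" where
  "periodic1 f \<longleftrightarrow> (\<forall>x. f (x + 1) = f x)"

definition cadlag :: "(real \<Rightarrow> real) \<Rightarrow> bool" where
  "cadlag f \<longleftrightarrow> (\<forall>x. continuous (at_right x) f \<and> (\<exists>l. (f \<longlongrightarrow> l) (at_left x)))"

definition caglad :: "(real \<Rightarrow> real) \<Rightarrow> bool" where
  "caglad f \<longleftrightarrow> (\<forall>x. continuous (at_left x) f \<and> (\<exists>l. (f \<longlongrightarrow> l) (at_right x)))"

text \<open>
  The library measure \<^const>\<open>interval_measure\<close> \<open>F\<close>, which gives \<open>(a, b]\<close> the mass \<open>F b - F a\<close>,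
  needs a right-continuous \<open>F\<close>. For a left-continuous \<open>V\<close> we reflect the line: the measure below
  gives \<open>[a, b)\<close> the mass \<open>V b - V a\<close>, as shown in the lemma that follows.
\<close>

definition left_interval_measure :: "(real \<Rightarrow> real) \<Rightarrow> real measure" where
  "left_interval_measure V = distr (interval_measure (\<lambda>x. - V (- x))) borel uminus"

lemma emeasure_left_interval_measure_Ico:
  assumes "mono V" and "\<And>x. continuous (at_left x) V" and "a \<le> b"
  shows "emeasure (left_interval_measure V) {a..<b} = ennreal (V b - V a)"
proof -
  let ?F = "\<lambda>x. - V (- x)"
  have cont: "continuous (at_right x) ?F" for x
  proof -
    have "(V \<longlongrightarrow> V (- x)) (at_left (- x))"
      using assms(2)[of "- x"] by (simp add: continuous_within)
    then have "((\<lambda>y. V (- y)) \<longlongrightarrow> V (- x)) (at_right x)"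
      by (simp add: at_left_minus filterlim_filtermap)
    then show ?thesis
      by (simp add: continuous_within tendsto_minus)
  qed
  have "uminus -` {a..<b} \<inter> space (interval_measure ?F) = {- b<..- a}"
    by auto
  then have "emeasure (left_interval_measure V) {a..<b} = emeasure (interval_measure ?F) {- b<..- a}"
    unfolding left_interval_measure_def by (subst emeasure_distr) auto
  also have "\<dots> = ennreal (?F (- a) - ?F (- b))"
    using assms cont by (intro emeasure_interval_measure_Ioc) (auto intro: monoD[OF assms(1)])
  finally show ?thesis by simp
qed

text \<open>
  The distribution functions of interest are continuous at the integers, so it is immaterial which
  end point of the fundamental domain is included.
\<close>

definition dW_torus :: "(real \<Rightarrow> real) \<Rightarrow> real measure" where
  "dW_torus W = restrict_space (interval_measure W) {0<..1}"

definition dV_torus :: "(real \<Rightarrow> real) \<Rightarrow> real measure" where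
  "dV_torus V = restrict_space (left_interval_measure V) {0..<1}"

definition L2_torus :: "real measure \<Rightarrow> (real \<Rightarrow> real) set" where
  "L2_torus \<mu> = {f. periodic1 f \<and> f \<in> borel_measurable borel \<and> integrable \<mu> (\<lambda>x. (f x)\<^sup>2)}"

text \<open>
  For a set \<open>A\<close> of functions, \<open>A // ae_equal_L2 \<mu>\<close> is the set of the classes in \<open>L\<^sup>2(\<mu>)\<close> of its
  elements; \<open>A\<close> itself need not be closed under almost everywhere equality.
\<close>

definition ae_equal_L2 :: "real measure \<Rightarrow> ((real \<Rightarrow> real) \<times> (real \<Rightarrow> real)) set" where
  "ae_equal_L2 \<mu> = {(f, g). f \<in> L2_torus \<mu> \<and> g \<in> L2_torus \<mu> \<and> (AE x in \<mu>. f x = g x)}"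

definition diff_quot :: "(real \<Rightarrow> real) \<Rightarrow> (real \<Rightarrow> real) \<Rightarrow> real \<Rightarrow> real \<Rightarrow> real" where
  "diff_quot U f x h = (f (x + h) - f x) / (U (x + h) - U x)"

definition D_minus_exists :: "(real \<Rightarrow> real) \<Rightarrow> (real \<Rightarrow> real) \<Rightarrow> bool" where
  "D_minus_exists W f \<longleftrightarrow> (\<forall>x. \<exists>l. (diff_quot W f x \<longlongrightarrow> l) (at_left 0))"

definition D_plus_exists :: "(real \<Rightarrow> real) \<Rightarrow> (real \<Rightarrow> real) \<Rightarrow> bool" where
  "D_plus_exists V g \<longleftrightarrow> (\<forall>x. \<exists>l. (diff_quot V g x \<longlongrightarrow> l) (at_right 0))"

definition D_minus :: "(real \<Rightarrow> real) \<Rightarrow> (real \<Rightarrow> real) \<Rightarrow> real \<Rightarrow> real" where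
  "D_minus W f x = Lim (at_left 0) (diff_quot W f x)"

definition D_plus :: "(real \<Rightarrow> real) \<Rightarrow> (real \<Rightarrow> real) \<Rightarrow> real \<Rightarrow> real" where
  "D_plus V g x = Lim (at_right 0) (diff_quot V g x)"

primrec D_WV :: "(real \<Rightarrow> real) \<Rightarrow> (real \<Rightarrow> real) \<Rightarrow> nat \<Rightarrow> (real \<Rightarrow> real) \<Rightarrow> real \<Rightarrow> real" where
  "D_WV W V 0 f = f"
| "D_WV W V (Suc n) f = (if even n then D_minus W (D_WV W V n f) else D_plus V (D_WV W V n f))"

primrec D_VW :: "(real \<Rightarrow> real) \<Rightarrow> (real \<Rightarrow> real) \<Rightarrow> nat \<Rightarrow> (real \<Rightarrow> real) \<Rightarrow> real \<Rightarrow> real" where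
  "D_VW V W 0 g = g"
| "D_VW V W (Suc n) g = (if even n then D_plus V (D_VW V W n g) else D_minus W (D_VW V W n g))"

definition C0_torus :: "(real \<Rightarrow> real) \<Rightarrow> (real \<Rightarrow> real) set" where
  "C0_torus V = {f. periodic1 f \<and> cadlag f \<and> (\<integral>x. f x \<partial>dV_torus V) = 0}"

definition C1_torus :: "(real \<Rightarrow> real) \<Rightarrow> (real \<Rightarrow> real) set" where
  "C1_torus W = {f. periodic1 f \<and> caglad f \<and> (\<integral>x. f x \<partial>dW_torus W) = 0}"

definition Cinf0_WV :: "(real \<Rightarrow> real) \<Rightarrow> (real \<Rightarrow> real) \<Rightarrow> (real \<Rightarrow> real) set" where
  "Cinf0_WV W V = {f \<in> C0_torus V. \<forall>n.
     if even n then D_minus_exists W (D_WV W V n f) \<and> D_WV W V (Suc n) f \<in> C1_torus W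
     else D_plus_exists V (D_WV W V n f) \<and> D_WV W V (Suc n) f \<in> C0_torus V}"

definition Cinf0_VW :: "(real \<Rightarrow> real) \<Rightarrow> (real \<Rightarrow> real) \<Rightarrow> (real \<Rightarrow> real) set" where
  "Cinf0_VW V W = {g \<in> C1_torus W. \<forall>n.
     if even n then D_plus_exists V (D_VW V W n g) \<and> D_VW V W (Suc n) g \<in> C0_torus V
     else D_minus_exists W (D_VW V W n g) \<and> D_VW V W (Suc n) g \<in> C1_torus W}"

definition Cinf_WV :: "(real \<Rightarrow> real) \<Rightarrow> (real \<Rightarrow> real) \<Rightarrow> (real \<Rightarrow> real) set" where
  "Cinf_WV W V = {(\<lambda>x. c + f x) | c f. f \<in> Cinf0_WV W V}"

definition Cinf_VW :: "(real \<Rightarrow> real) \<Rightarrow> (real \<Rightarrow> real) \<Rightarrow> (real \<Rightarrow> real) set" where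
  "Cinf_VW V W = {(\<lambda>x. c + g x) | c g. g \<in> Cinf0_VW V W}"

definition weak_D_minus ::
  "(real \<Rightarrow> real) \<Rightarrow> (real \<Rightarrow> real) \<Rightarrow> (real \<Rightarrow> real) \<Rightarrow> (real \<Rightarrow> real) \<Rightarrow> bool" where
  "weak_D_minus W V f F \<longleftrightarrow> f \<in> L2_torus (dV_torus V) \<and> F \<in> L2_torus (dW_torus W) \<and>
     (\<forall>g\<in>Cinf_VW V W.
        (\<integral>x. f x * D_plus V g x \<partial>dV_torus V) = - (\<integral>x. F x * g x \<partial>dW_torus W))"

definition weak_D_plus ::
  "(real \<Rightarrow> real) \<Rightarrow> (real \<Rightarrow> real) \<Rightarrow> (real \<Rightarrow> real) \<Rightarrow> (real \<Rightarrow> real) \<Rightarrow> bool" where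
  "weak_D_plus W V h H \<longleftrightarrow> h \<in> L2_torus (dW_torus W) \<and> H \<in> L2_torus (dV_torus V) \<and>
     (\<forall>g\<in>Cinf_WV W V.
        (\<integral>x. h x * D_minus W g x \<partial>dW_torus W) = - (\<integral>x. H x * g x \<partial>dV_torus V))"

text \<open>
  A weak derivative is only determined up to null sets, so iterated weak differentiation is a
  relation between representatives: \<open>weak_D_WV W V n f F\<close> says that \<open>F\<close> represents the weak
  derivative of \<open>f\<close> of order \<open>n\<close>.
\<close>

primrec weak_D_WV ::
  "(real \<Rightarrow> real) \<Rightarrow> (real \<Rightarrow> real) \<Rightarrow> nat \<Rightarrow> (real \<Rightarrow> real) \<Rightarrow> (real \<Rightarrow> real) \<Rightarrow> bool" where
  "weak_D_WV W V 0 f F \<longleftrightarrow> F = f"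
| "weak_D_WV W V (Suc n) f F \<longleftrightarrow>
     (\<exists>G. weak_D_WV W V n f G \<and> (if even n then weak_D_minus W V G F else weak_D_plus W V G F))"

definition H_WV :: "nat \<Rightarrow> (real \<Rightarrow> real) \<Rightarrow> (real \<Rightarrow> real) \<Rightarrow> (real \<Rightarrow> real) set" where
  "H_WV k W V = {f \<in> L2_torus (dV_torus V). \<forall>n\<in>{1..k}. \<exists>F. weak_D_WV W V n f F}"

definition Hinf_WV :: "(real \<Rightarrow> real) \<Rightarrow> (real \<Rightarrow> real) \<Rightarrow> (real \<Rightarrow> real) set" where
  "Hinf_WV W V = (\<Inter>k\<in>{1..}. H_WV k W V)"

end

theory Submission
  imports Defs
begin

text \<open>
  Strong derivatives are weak derivatives by integration by parts, so the smooth functions belong to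
  every Sobolev space. The content of the theorem is the converse, and everything in it rests on
  one fact: the test functions are plentiful enough to detect that a function is constant
  (\<open>du_Bois_Reymond\<close>).

  Given this, let \<open>F\<close> be the weak derivative of \<open>f\<close>, and \<open>p\<close> a primitive of \<open>F\<close>. Integration by parts shows
  that \<open>f - p\<close> is orthogonal to the derivatives of all test functions, so \<open>f\<close> agrees almost
  everywhere with a primitive of \<open>F\<close> (\<open>weak_deriv_primitive\<close>). If \<open>f\<close> has weak derivatives of every order,
  then each of them has such a representative, and each representative is a primitive of the next
  one. As a primitive, a representative is continuous from one side, and this is the side that makes
  the one-sided derivative of its own primitive exist at every point. Hence the first
  representative has all strong derivatives (\<open>Hinf_imp_smooth\<close>).

  The test functions are found without spectral theory. A smooth function with mean zero is one that
  can be written as an \<open>n\<close>-fold primitive of a regular function for every \<open>n\<close>, compatibly in \<open>n\<close>. Integration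
  is continuous from \<open>L\<^sup>1\<close> to the bounded functions, and its range is, up to constants, dense in \<open>L\<^sup>1\<close>, because a
  caglad function is the pointwise limit of functions that are piecewise affine in \<open>V\<close>, and
  symmetrically for cadlag functions and \<open>W\<close> (\<open>regulated_approximation_by_primitives\<close>). For operators of
  this kind, a Mittag-Leffler argument shows that the intersection of the ranges of all iterates
  is still dense (\<open>smooth_approximation\<close>). So a function \<open>u\<close> orthogonal to the smooth functions with
  mean zero is orthogonal to every antiderivative with mean zero. Let \<open>U\<close> be the primitive with mean zero
  of \<open>u\<close> minus its mean. Testing \<open>u\<close> with the antiderivative of \<open>U\<close> gives \<open>U = 0\<close>, and \<open>u\<close> is constant.

  The fundamental theorem that links strong derivatives to primitives is proved once, for
  right-continuous integrators; the left-continuous integrator is reduced to it by reflecting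
  the line.
\<close>

section \<open>Periodic cadlag and caglad functions\<close>

lemma periodic1_shift:
  assumes "periodic1 f"
  shows "f (x + of_int k) = f x"
proof -
  have up: "f (x + of_nat n) = f x" for n x
  proof (induction n)
    case (Suc n)
    have "f (x + of_nat (Suc n)) = f ((x + of_nat n) + 1)" by (simp add: algebra_simps)
    with Suc assms show ?case by (simp add: periodic1_def)
  qed simp
  show ?thesis
  proof (cases "k \<ge> 0")
    case True
    then show ?thesis using up[of x "nat k"] by simp
  next
    case False
    then show ?thesis using up[of "x + of_int k" "nat (-k)"] by simp
  qed
qed

lemma periodic1_uminus: "periodic1 (\<lambda>x. f (- x)) \<longleftrightarrow> periodic1 f"
proof -
  have "periodic1 (\<lambda>x. f (- x))" if "periodic1 f" for f
    unfolding periodic1_def using periodic1_shift[OF that, where k = "-1"]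
    by (simp add: algebra_simps)
  from this[of f] this[of "\<lambda>x. f (- x)"] show ?thesis by auto
qed

lemma quasiperiodic_shift:
  fixes U :: "real \<Rightarrow> real"
  assumes "\<And>x. U (x + 1) - U x = U 1 - U 0"
  shows "U (x + of_int k) = U x + of_int k * (U 1 - U 0)"
proof -
  have "periodic1 (\<lambda>x. U x - x * (U 1 - U 0))"
    unfolding periodic1_def
  proof
    fix x
    show "U (x + 1) - (x + 1) * (U 1 - U 0) = U x - x * (U 1 - U 0)"
      using assms[of x] by (simp add: distrib_right)
  qed
  from periodic1_shift[OF this, of x k] show ?thesis
    by (simp add: algebra_simps)
qed

lemma cadlag_uminus: "cadlag (\<lambda>x. f (- x)) \<longleftrightarrow> caglad f"
proof -
  have "continuous (at_right x) (\<lambda>x. f (- x)) \<longleftrightarrow> continuous (at_left (- x)) f" for x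
    by (simp add: continuous_within filterlim_at_left_to_right[of f])
  moreover have "((\<lambda>x. f (- x)) \<longlongrightarrow> l) (at_left x) \<longleftrightarrow> (f \<longlongrightarrow> l) (at_right (- x))" for x l
    by (simp add: at_left_minus filterlim_filtermap)
  moreover have "(\<forall>x. P (- x)) \<longleftrightarrow> (\<forall>x. P x)" for P :: "real \<Rightarrow> bool"
    by (metis minus_minus)
  ultimately show ?thesis
    unfolding cadlag_def caglad_def by simp
qed

lemma caglad_uminus: "caglad (\<lambda>x. f (- x)) \<longleftrightarrow> cadlag f"
  using cadlag_uminus[of "\<lambda>x. f (- x)"] by simp

lemma caglad_diff: "caglad f \<Longrightarrow> caglad g \<Longrightarrow> caglad (\<lambda>x. f x - g x)"
  unfolding caglad_def by (blast intro: continuous_diff tendsto_diff)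

lemma caglad_const: "caglad (\<lambda>_. a)"
  unfolding caglad_def by auto

lemma caglad_neg: "caglad f \<Longrightarrow> caglad (\<lambda>x. - f x)"
  using caglad_diff[OF caglad_const[of 0]] by simp

lemma cadlag_diff: "cadlag f \<Longrightarrow> cadlag g \<Longrightarrow> cadlag (\<lambda>x. f x - g x)"
  unfolding cadlag_def by (blast intro: continuous_diff tendsto_diff)

lemma cadlag_const: "cadlag (\<lambda>_. a)"
  unfolding cadlag_def by auto

lemma cadlag_neg: "cadlag f \<Longrightarrow> cadlag (\<lambda>x. - f x)"
  using cadlag_diff[OF cadlag_const[of 0]] by simp

text \<open>
  Sampling a left-continuous function at these grid points recovers its value at \<open>x\<close>, because
  they approach \<open>x\<close> from strictly below. A shift by \<open>k\<close> samples \<open>k\<close> mesh widths earlier.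
\<close>

lemma ceiling_grid_at_left:
  fixes x :: real and k :: int
  assumes that: "k \<ge> 0"
  shows "filterlim (\<lambda>n. (of_int (\<lceil>real (Suc n) * x\<rceil> - 1 - k)) / real (Suc n)) (at_left x) sequentially"
  unfolding filterlim_at
proof (intro conjI always_eventually allI)
  fix n
  let ?g = "\<lambda>n. (of_int (\<lceil>real (Suc n) * x\<rceil> - 1 - k)) / real (Suc n)"
  have up: "?g n < x" for n
  proof -
    have "of_int (\<lceil>real (Suc n) * x\<rceil> - 1 - k) < real (Suc n) * x"
      using ceiling_correct[of "real (Suc n) * x"] that
      by (smt (verit, best) of_int_0_le_iff of_int_diff of_int_1)
    then show ?thesis by (simp add: divide_less_eq mult.commute)
  qed
  have lo: "x - (1 + of_int k) / real (Suc n) \<le> ?g n" for n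
  proof -
    have "real (Suc n) * x - (1 + of_int k) \<le> of_int (\<lceil>real (Suc n) * x\<rceil> - 1 - k)"
      using ceiling_correct[of "real (Suc n) * x"] by simp
    then have "(real (Suc n) * x - (1 + of_int k)) / real (Suc n) \<le> ?g n"
      by (intro divide_right_mono) auto
    then show ?thesis by (simp add: diff_divide_distrib)
  qed
  show "?g n \<in> {..<x}" "?g n \<noteq> x" using up[of n] by auto
  have "(\<lambda>n. x - (1 + of_int k) * (1 / real (Suc n))) \<longlonglongrightarrow> x - (1 + of_int k) * 0"
    by (intro tendsto_intros LIMSEQ_Suc lim_1_over_n)
  then have lim: "(\<lambda>n. x - (1 + of_int k) / real (Suc n)) \<longlonglongrightarrow> x" by simp
  show "?g \<longlonglongrightarrow> x"
    by (rule tendsto_sandwich[OF _ _ lim tendsto_const])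
      (use lo up less_imp_le in \<open>blast intro: always_eventually\<close>)+
qed

text \<open>
  The function is the pointwise limit of its samples at the grid points below \<open>x\<close>, and each sampled
  function factors through the integers.
\<close>

lemma caglad_borel_measurable:
  assumes "caglad f"
  shows "f \<in> borel_measurable borel"
proof (rule borel_measurable_LIMSEQ_real)
  fix x :: real
  have "(f \<longlongrightarrow> f x) (at_left x)"
    using assms by (simp add: caglad_def continuous_within)
  from filterlim_compose[OF this ceiling_grid_at_left[of 0 x]]
  show "(\<lambda>n. f (of_int (\<lceil>real (Suc n) * x\<rceil> - 1) / real (Suc n))) \<longlonglongrightarrow> f x"
    by simp
next
  fix n
  have "(\<lambda>k::int. f (of_int (k - 1) / real (Suc n))) \<in> measurable (count_space UNIV) borel"
    by simp
  moreover have "(\<lambda>x::real. \<lceil>real (Suc n) * x\<rceil>) \<in> measurable borel (count_space UNIV)"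
    by measurable
  ultimately show "(\<lambda>x. f (of_int (\<lceil>real (Suc n) * x\<rceil> - 1) / real (Suc n))) \<in> borel_measurable borel"
    using measurable_compose by blast
qed

text \<open>
  One-sided limits on both sides bound the function near every point; compactness of the unit
  interval and periodicity do the rest.
\<close>

lemma caglad_periodic_bounded:
  assumes "caglad f" "periodic1 f"
  obtains B where "B > 0" "\<And>x. \<bar>f x\<bar> \<le> B"
proof -
  have "\<exists>B. \<forall>y\<in>{0..1}. \<bar>f y\<bar> \<le> B"
  proof (rule Bolzano[of 0 1 "\<lambda>a b. \<exists>B. \<forall>y\<in>{a..b}. \<bar>f y\<bar> \<le> B"])
    fix a b c
    assume "\<exists>B. \<forall>y\<in>{a..b}. \<bar>f y\<bar> \<le> B" "\<exists>B. \<forall>y\<in>{b..c}. \<bar>f y\<bar> \<le> B"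
    then obtain B B' where "\<forall>y\<in>{a..b}. \<bar>f y\<bar> \<le> B" "\<forall>y\<in>{b..c}. \<bar>f y\<bar> \<le> B'"
      by auto
    then have "\<bar>f y\<bar> \<le> max B B'" if "y \<in> {a..c}" for y
      using that by (cases "y \<le> b") (auto simp: le_max_iff_disj)
    then show "\<exists>B. \<forall>y\<in>{a..c}. \<bar>f y\<bar> \<le> B" by blast
  next
    fix x
    from assms obtain l where l: "(f \<longlongrightarrow> l) (at_right x)" and r: "(f \<longlongrightarrow> f x) (at_left x)"
      unfolding caglad_def continuous_within by metis
    have bd: "\<forall>\<^sub>F y in F. \<bar>f y\<bar> \<le> \<bar>m\<bar> + 1" if "(f \<longlongrightarrow> m) F" for F m
      using tendstoD[OF that, of 1] by (auto elim!: eventually_mono simp: dist_real_def)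
    from bd[OF r] obtain p where p: "p < x" "\<And>y. p < y \<Longrightarrow> y < x \<Longrightarrow> \<bar>f y\<bar> \<le> \<bar>f x\<bar> + 1"
      unfolding eventually_at_left_field by blast
    from bd[OF l] obtain q where q: "x < q" "\<And>y. x < y \<Longrightarrow> y < q \<Longrightarrow> \<bar>f y\<bar> \<le> \<bar>l\<bar> + 1"
      unfolding eventually_at_right_field by blast
    have "\<bar>f y\<bar> \<le> max (\<bar>f x\<bar> + 1) (\<bar>l\<bar> + 1)" if "p < y" "y < q" for y
      using p(2)[of y] q(2)[of y] that by (cases y x rule: linorder_cases) auto
    then show "\<exists>d>0. \<forall>a b. a \<le> x \<and> x \<le> b \<and> b - a < d \<longrightarrow> (\<exists>B. \<forall>y\<in>{a..b}. \<bar>f y\<bar> \<le> B)"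
      using p(1) q(1)
      by (intro exI[of _ "min (x - p) (q - x)"] conjI allI impI exI[of _ "max (\<bar>f x\<bar> + 1) (\<bar>l\<bar> + 1)"]) auto
  qed simp
  then obtain B where B: "\<And>y. 0 \<le> y \<Longrightarrow> y \<le> 1 \<Longrightarrow> \<bar>f y\<bar> \<le> B" by (meson atLeastAtMost_iff)
  show ?thesis
  proof (rule that[of "\<bar>B\<bar> + 1"])
    fix x
    have "f x = f (x - of_int \<lfloor>x\<rfloor>)"
      using periodic1_shift[OF assms(2), of x "- \<lfloor>x\<rfloor>"] by simp
    moreover have "0 \<le> x - of_int \<lfloor>x\<rfloor>" "x - of_int \<lfloor>x\<rfloor> \<le> 1" by linarith+
    ultimately show "\<bar>f x\<bar> \<le> \<bar>B\<bar> + 1" using B[of "x - of_int \<lfloor>x\<rfloor>"] by auto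
  qed simp
qed

text \<open>
  One-sided limits and uniform limits can be interchanged. The right limits converge because they
  are at most as far apart from each other as the functions are.
\<close>

lemma caglad_uniform_limit:
  assumes "\<And>n::nat. caglad (f n)" "uniform_limit UNIV f g sequentially"
  shows "caglad g"
  unfolding caglad_def
proof (intro allI conjI)
  fix x :: real
  have nt: "sequentially \<noteq> bot" by simp
  have ul: "\<forall>\<^sub>F n in sequentially. \<forall>y. dist (f n y) (g y) < e" if "e > 0" for e
    using uniform_limitD[OF assms(2) that] by simp
  have "((\<lambda>y. g y) \<longlongrightarrow> g x) (at_left x)"
  proof (rule swap_uniform_limit'[OF _ _ _ _ nt])
    show "\<forall>\<^sub>F n in sequentially. (f n \<longlongrightarrow> f n x) (at_left x)"
      using assms(1) by (simp add: caglad_def continuous_within)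
    show "((\<lambda>n. f n x) \<longlongrightarrow> g x) sequentially"
      using tendsto_uniform_limitI[OF assms(2)] by simp
    show "uniform_limit UNIV f g sequentially" by fact
  qed auto
  then show "continuous (at_left x) g" by (simp add: continuous_within)
  have "\<forall>n. \<exists>l. (f n \<longlongrightarrow> l) (at_right x)"
    using assms(1) by (simp add: caglad_def)
  then obtain l where l: "\<And>n. (f n \<longlongrightarrow> l n) (at_right x)"
    by metis
  have "Cauchy l"
  proof (rule metric_CauchyI)
    fix e :: real assume e: "e > 0"
    from ul[of "e/4"] e obtain N where N: "\<And>n y. n \<ge> N \<Longrightarrow> dist (f n y) (g y) < e/4"
      unfolding eventually_sequentially by auto
    show "\<exists>M. \<forall>m\<ge>M. \<forall>n\<ge>M. dist (l m) (l n) < e"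
    proof (intro exI[of _ N] allI impI)
      fix m n assume mn: "N \<le> m" "N \<le> n"
      have "((\<lambda>y. dist (f m y) (f n y)) \<longlongrightarrow> dist (l m) (l n)) (at_right x)"
        by (intro tendsto_intros l)
      moreover have "dist (f m y) (f n y) \<le> e/2" for y
        using N[OF mn(1), of y] N[OF mn(2), of y] unfolding dist_real_def by linarith
      ultimately have "dist (l m) (l n) \<le> e/2"
        by (intro tendsto_upperbound) auto
      with e show "dist (l m) (l n) < e" by simp
    qed
  qed
  then obtain L where "l \<longlonglongrightarrow> L" using Cauchy_convergent_iff convergentD by blast
  then have "(g \<longlongrightarrow> L) (at_right x)"
    by (intro swap_uniform_limit'[OF _ _ assms(2) _ nt]) (use l in auto)
  then show "\<exists>l. (g \<longlongrightarrow> l) (at_right x)" ..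
qed

section \<open>Primitives with respect to a right-continuous integrator\<close>

text \<open>
  The base point \<open>c\<close> is a parameter because the reflection \<open>x \<mapsto> -x\<close> takes the fundamental domain
  \<open>[0, 1)\<close> of a left-continuous integrator to the cell \<open>(-1, 0]\<close> of a right-continuous one.
\<close>

definition cell_measure :: "(real \<Rightarrow> real) \<Rightarrow> real \<Rightarrow> real measure" where
  "cell_measure U c = restrict_space (interval_measure U) {c<..c + 1}"

text \<open>
  A condition on increments instead of on values measured from a base point: this form is
  symmetric under reflection.
\<close>

definition primitive_on_cell ::
  "(real \<Rightarrow> real) \<Rightarrow> real \<Rightarrow> (real \<Rightarrow> real) \<Rightarrow> (real \<Rightarrow> real) \<Rightarrow> bool" where
  "primitive_on_cell U c F f \<longleftrightarrow>
     (\<forall>s t. c \<le> s \<longrightarrow> s \<le> t \<longrightarrow> t \<le> c + 1 \<longrightarrow> f t - f s = (LINT x:{s<..t}|cell_measure U c. F x))"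

lemma space_cell_measure: "space (cell_measure U c) = {c<..c + 1}"
  by (simp add: cell_measure_def space_restrict_space)

lemma borel_measurable_cell_measure [measurable (raw)]:
  "f \<in> borel_measurable borel \<Longrightarrow> f \<in> borel_measurable (cell_measure U c)"
  unfolding cell_measure_def by (rule measurable_restrict_space1) simp

lemma set_integrable_cell:
  fixes F :: "real \<Rightarrow> real"
  assumes "integrable (cell_measure U c) F" "A \<in> sets borel"
  shows "integrable (cell_measure U c) (\<lambda>x. indicator A x * F x)"
proof -
  have "A \<inter> {c<..c+1} \<in> sets (cell_measure U c)"
    unfolding cell_measure_def sets_restrict_space using assms(2) by (auto simp: Int_commute)
  from integrable_mult_indicator[OF this assms(1)]
  have "integrable (cell_measure U c) (\<lambda>x. indicator (A \<inter> {c<..c+1}) x *\<^sub>R F x)" .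
  then show ?thesis
    by (rule Bochner_Integration.integrable_cong[THEN iffD1, rotated 2])
      (auto simp: space_cell_measure indicator_def)
qed

locale right_integrator =
  fixes U :: "real \<Rightarrow> real"
  assumes strict: "strict_mono U" and cadlag: "cadlag U"
    and quasi: "\<And>x. U (x + 1) - U x = U 1 - U 0"
begin

lemma U_less: "x < y \<Longrightarrow> U x < U y"
  using strict by (simp add: strict_mono_def)

lemma U_le: "x \<le> y \<Longrightarrow> U x \<le> U y"
  using strict by (simp add: strict_mono_less_eq)

lemma U_right: "continuous (at_right x) U"
  using cadlag by (simp add: cadlag_def)

lemma emeasure_cell: "c \<le> s \<Longrightarrow> s \<le> t \<Longrightarrow> t \<le> c + 1 \<Longrightarrow> emeasure (cell_measure U c) {s<..t} = ennreal (U t - U s)"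
  unfolding cell_measure_def
  by (subst emeasure_restrict_space) (auto intro!: emeasure_interval_measure_Ioc simp: U_le U_right)

lemma measure_cell: "c \<le> s \<Longrightarrow> s \<le> t \<Longrightarrow> t \<le> c + 1 \<Longrightarrow> measure (cell_measure U c) {s<..t} = U t - U s"
  unfolding measure_def by (simp add: emeasure_cell U_le)

sublocale finite_measure "cell_measure U c" for c
  by standard (use emeasure_cell[of c c "c + 1"] in \<open>simp add: space_cell_measure\<close>)

lemma measure_cell_space: "measure (cell_measure U c) (space (cell_measure U c)) = U (c + 1) - U c"
  using measure_cell[of c c "c + 1"] by (simp add: space_cell_measure)

lemma integral_const_cell:
  assumes "c \<le> s" "s \<le> t" "t \<le> c + 1"
  shows "(LINT x:{s<..t}|cell_measure U c. a) = a * (U t - U s)"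
proof -
  have "{s<..t} \<in> sets (cell_measure U c)"
    unfolding cell_measure_def sets_restrict_space using assms by auto
  then show ?thesis
    using measure_cell[OF assms] by (simp add: set_integral_const emeasure_cell[OF assms])
qed

text \<open>
  The estimate behind differentiating an integral: on a short interval, the integral of a
  one-sidedly continuous \<open>F\<close> is nearly a value of \<open>F\<close> times the mass.
\<close>

lemma integral_deviation_le:
  assumes F: "integrable (cell_measure U c) F" and st: "c \<le> s" "s \<le> t" "t \<le> c + 1"
    and close: "\<And>x. s < x \<Longrightarrow> x \<le> t \<Longrightarrow> \<bar>F x - a\<bar> \<le> e"
  shows "\<bar>(LINT x:{s<..t}|cell_measure U c. F x) - a * (U t - U s)\<bar> \<le> e * (U t - U s)"
proof -
  let ?M = "cell_measure U c"
  have const: "(\<integral>x. indicator {s<..t} x * b \<partial>?M) = b * (U t - U s)" for b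
    using integral_const_cell[OF st, of b] unfolding set_lebesgue_integral_def by (simp only: real_scaleR_def)
  have i: "integrable ?M (\<lambda>x. indicator {s<..t} x * F x)" "integrable ?M (\<lambda>x. indicator {s<..t} x * a)"
    "integrable ?M (\<lambda>x. indicator {s<..t} x * e)"
    by (intro set_integrable_cell F integrable_const; simp)+
  have "(LINT x:{s<..t}|?M. F x) - a * (U t - U s) = (\<integral>x. indicator {s<..t} x * F x - indicator {s<..t} x * a \<partial>?M)"
    unfolding set_lebesgue_integral_def real_scaleR_def
    by (subst Bochner_Integration.integral_diff[OF i(1,2)]) (simp only: const)
  also have "\<bar>\<dots>\<bar> \<le> (\<integral>x. indicator {s<..t} x * e \<partial>?M)"
  proof (rule integral_abs_bound[THEN order_trans], rule integral_mono)
    show "\<bar>indicator {s<..t} x * F x - indicator {s<..t} x * a\<bar> \<le> indicator {s<..t} x * e" for x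
      using close[of x] by (auto simp: indicator_def)
  qed (use i in auto)
  also have "\<dots> = e * (U t - U s)"
    by (rule const)
  finally show ?thesis .
qed

lemma primitive_on_cellI:
  assumes "integrable (cell_measure U c) F" "\<And>t. c \<le> t \<Longrightarrow> t \<le> c + 1 \<Longrightarrow> f t = f c + (LINT x:{..t}|cell_measure U c. F x)"
  shows "primitive_on_cell U c F f"
  unfolding primitive_on_cell_def
proof (intro allI impI)
  fix s t :: real assume st: "c \<le> s" "s \<le> t" "t \<le> c + 1"
  let ?M = "cell_measure U c"
  have i: "integrable ?M (\<lambda>x. indicator {..r} x * F x)" for r
    by (intro set_integrable_cell assms) auto
  have "f t - f s = (\<integral>x. indicator {..t} x * F x - indicator {..s} x * F x \<partial>?M)"
    using st assms(2)[of t] assms(2)[of s] i[of t] i[of s] by (simp add: set_lebesgue_integral_def)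
  also have "(\<lambda>x. indicator {..t} x * F x - indicator {..s} x * F x) = (\<lambda>x. indicator {s<..t} x * F x)"
    using st by (auto simp: indicator_def fun_eq_iff)
  finally show "f t - f s = (LINT x:{s<..t}|?M. F x)"
    by (simp add: set_lebesgue_integral_def)
qed

text \<open>
  The integral from \<open>c\<close> vanishes again at \<open>c + 1\<close> because \<open>F\<close> has mean zero, so its periodic
  extension from the cell has no defect at the end points.
\<close>

lemma periodic_primitive_exists:
  assumes F: "integrable (cell_measure U c) F" and mean: "(\<integral>x. F x \<partial>cell_measure U c) = 0"
  shows "\<exists>f. periodic1 f \<and> primitive_on_cell U c F f"
proof (intro exI conjI)
  let ?M = "cell_measure U c"
  define J where "J t = (LINT x:{..t}|?M. F x)" for t
  define f where "f t = J (t - of_int \<lfloor>t - c\<rfloor>)" for t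
  have J0: "J c = 0"
    unfolding J_def set_lebesgue_integral_def
    by (subst Bochner_Integration.integral_cong[where g = "\<lambda>_. 0", OF refl]) (auto simp: space_cell_measure)
  have J1: "J (c + 1) = 0"
    unfolding J_def set_lebesgue_integral_def mean[symmetric]
    by (rule Bochner_Integration.integral_cong) (auto simp: space_cell_measure)
  show "periodic1 f"
    unfolding periodic1_def
  proof
    fix x
    have "\<lfloor>x + 1 - c\<rfloor> = \<lfloor>x - c\<rfloor> + 1" using floor_add_int[of "x - c" 1] by (simp add: algebra_simps)
    then show "f (x + 1) = f x" by (simp add: f_def algebra_simps)
  qed
  have "f t = J t" if "c \<le> t" "t \<le> c + 1" for t
  proof (cases "t = c + 1")
    case True then show ?thesis using J0 J1 by (simp add: f_def)
  next
    case False
    with that have "\<lfloor>t - c\<rfloor> = 0" by (auto simp: floor_eq_iff)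
    then show ?thesis by (simp add: f_def)
  qed
  then show "primitive_on_cell U c F f"
    by (intro primitive_on_cellI F) (simp_all add: J0, simp add: J_def)
qed

text \<open>
  Both follow by dominated convergence: as \<open>y\<close> tends to \<open>x\<close>, the interval \<open>(x, y]\<close> shrinks to the
  empty set and \<open>(y, x]\<close> shrinks to the point \<open>x\<close>, whose mass is the jump of \<open>U\<close>.
\<close>

lemma
  assumes f: "primitive_on_cell U c F f" and F: "integrable (cell_measure U c) F"
  shows primitive_on_cell_right_continuous:
      "c \<le> x \<Longrightarrow> x < c + 1 \<Longrightarrow> (f \<longlongrightarrow> f x) (at_right x)"
    and primitive_on_cell_left_limit:
      "c < x \<Longrightarrow> x \<le> c + 1 \<Longrightarrow> \<exists>l. (f \<longlongrightarrow> l) (at_left x)"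
proof -
  let ?M = "cell_measure U c"
  have Fm [measurable]: "F \<in> borel_measurable ?M" using F by auto
  have m [measurable]: "(\<lambda>x. indicator A x * F x) \<in> borel_measurable ?M" if "A \<in> sets borel" for A
    using set_integrable_cell[OF F that] by auto
  have dom: "AE x in ?M. norm (indicator A x * F x) \<le> norm (F x)" for A :: "real set"
    by (auto simp: indicator_def)
  have inc: "f t - f s = (\<integral>x. indicator {s<..t} x * F x \<partial>?M)" if "c \<le> s" "s \<le> t" "t \<le> c + 1" for s t
    using f that by (simp add: primitive_on_cell_def set_lebesgue_integral_def)
  show "(f \<longlongrightarrow> f x) (at_right x)" if x: "c \<le> x" "x < c + 1" for x
  proof (rule tendsto_at_right_sequentially)
    show "x < c + 1" by fact
    fix S :: "nat \<Rightarrow> real" assume S: "\<And>n. x < S n" "\<And>n. S n < c + 1" "decseq S" "S \<longlonglongrightarrow> x"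
    have "(\<lambda>n. \<integral>y. indicator {x<..S n} y * F y \<partial>?M) \<longlonglongrightarrow> (\<integral>y. 0 \<partial>?M)"
    proof (rule integral_dominated_convergence[where w = "\<lambda>y. norm (F y)"])
      show "AE y in ?M. (\<lambda>n. indicator {x<..S n} y * F y) \<longlonglongrightarrow> 0"
      proof (rule AE_I2)
        fix y
        have "\<forall>\<^sub>F n in sequentially. indicator {x<..S n} y * F y = 0"
        proof (cases "x < y")
          case True
          from order_tendstoD(2)[OF S(4) True] show ?thesis
            by eventually_elim (auto simp: indicator_def)
        qed (auto simp: indicator_def)
        then show "(\<lambda>n. indicator {x<..S n} y * F y) \<longlonglongrightarrow> 0"
          by (rule tendsto_eventually)
      qed
    qed (use F dom in auto)
    then have "(\<lambda>n. f (S n) - f x) \<longlonglongrightarrow> 0"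
      using inc[of x "S _"] x S(1,2) by (simp add: less_imp_le)
    then show "(\<lambda>n. f (S n)) \<longlonglongrightarrow> f x" by (simp add: LIM_zero_iff)
  qed
  have left: "(f \<longlongrightarrow> f x - (\<integral>y. indicator {x} y * F y \<partial>?M)) (at_left x)" if x: "c < x" "x \<le> c + 1" for x
  proof (rule tendsto_at_left_sequentially)
    show "c < x" by fact
    fix S :: "nat \<Rightarrow> real" assume S: "\<And>n. S n < x" "\<And>n. c < S n" "incseq S" "S \<longlonglongrightarrow> x"
    have "(\<lambda>n. \<integral>y. indicator {S n<..x} y * F y \<partial>?M) \<longlonglongrightarrow> (\<integral>y. indicator {x} y * F y \<partial>?M)"
    proof (rule integral_dominated_convergence[where w = "\<lambda>y. norm (F y)"])
      show "AE y in ?M. (\<lambda>n. indicator {S n<..x} y * F y) \<longlonglongrightarrow> indicator {x} y * F y"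
      proof (rule AE_I2)
        fix y
        have "\<forall>\<^sub>F n in sequentially. indicator {S n<..x} y * F y = indicator {x} y * F y"
        proof (cases "y < x")
          case True
          from order_tendstoD(1)[OF S(4) True] show ?thesis
            by eventually_elim (use True in \<open>auto simp: indicator_def\<close>)
        next
          case False
          then have "y \<in> {S n<..x} \<longleftrightarrow> y \<in> {x}" for n using S(1)[of n] by auto
          then show ?thesis by (simp add: indicator_def)
        qed
        then show "(\<lambda>n. indicator {S n<..x} y * F y) \<longlonglongrightarrow> indicator {x} y * F y"
          by (rule tendsto_eventually)
      qed
    qed (use F dom in auto)
    then have "(\<lambda>n. f x - (\<integral>y. indicator {S n<..x} y * F y \<partial>?M)) \<longlonglongrightarrow> f x - (\<integral>y. indicator {x} y * F y \<partial>?M)"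
      by (intro tendsto_intros)
    moreover have "f (S n) = f x - (\<integral>y. indicator {S n<..x} y * F y \<partial>?M)" for n
      using inc[of "S n" x] x less_imp_le[OF S(1)] less_imp_le[OF S(2)] by simp
    ultimately show "(\<lambda>n. f (S n)) \<longlonglongrightarrow> f x - (\<integral>y. indicator {x} y * F y \<partial>?M)"
      by simp
  qed
  show "\<exists>l. (f \<longlongrightarrow> l) (at_left x)" if "c < x" "x \<le> c + 1" for x
    using left[OF that] by blast
qed

lemma primitive_on_cell_cadlag:
  assumes f: "periodic1 f" "primitive_on_cell U c F f" and F: "integrable (cell_measure U c) F"
  shows "cadlag f"
proof -
  note right = primitive_on_cell_right_continuous[OF f(2) F]
  note left = primitive_on_cell_left_limit[OF f(2) F]
  show ?thesis
    unfolding cadlag_def continuous_within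
  proof (intro allI conjI)
    fix x :: real
    define k where "k = \<lfloor>x - c\<rfloor>"
    have "c \<le> x - of_int k" "x - of_int k < c + 1" unfolding k_def by linarith+
    from right[OF this] show "(f \<longlongrightarrow> f x) (at_right x)"
      using periodic1_shift[OF f(1), of "_ + x" "- k"] periodic1_shift[OF f(1), of x "- k"]
      by (simp add: filterlim_at_right_to_0[of f] algebra_simps)
    define j where "j = \<lceil>x - c\<rceil> - 1"
    have "c < x - of_int j" "x - of_int j \<le> c + 1" unfolding j_def by linarith+
    from left[OF this] obtain l where "(f \<longlongrightarrow> l) (at_left (x - of_int j))" by blast
    then have "((\<lambda>h. f (h + (x - of_int j))) \<longlongrightarrow> l) (at_left 0)"
      by (simp add: filterlim_at_left_to_right[of f] filterlim_at_left_to_right[where a = 0] filterlim_at_right_to_0[where a="of_int j - x"] algebra_simps)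
    moreover have "f (h + (x - of_int j)) = f (h + x)" for h
      using periodic1_shift[OF f(1), of "h + x" "- j"] by (simp add: algebra_simps)
    ultimately have "((\<lambda>h. f (h + x)) \<longlongrightarrow> l) (at_left 0)" by simp
    then have "(f \<longlongrightarrow> l) (at_left x)"
      by (simp add: filterlim_at_left_to_right[of f] filterlim_at_left_to_right[where a = 0] filterlim_at_right_to_0[where a="- x"] algebra_simps)
    then show "\<exists>l. (f \<longlongrightarrow> l) (at_left x)" ..
  qed
qed

lemma diff_quot_shift:
  assumes "periodic1 f"
  shows "diff_quot U f (x + of_int k) = diff_quot U f x"
proof
  fix h
  show "diff_quot U f (x + of_int k) h = diff_quot U f x h"
    using periodic1_shift[OF assms, of x k] periodic1_shift[OF assms, of "x + h" k]
      quasiperiodic_shift[OF quasi, of x k] quasiperiodic_shift[OF quasi, of "x + h" k]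
    by (simp add: diff_quot_def algebra_simps)
qed

lemma eventually_at_left_0:
  fixes x :: real
  shows "eventually P (at_left x) \<longleftrightarrow> eventually (\<lambda>h. P (x + h)) (at_left 0)"
  by (simp add: eventually_at_left_to_right[of P] eventually_at_left_to_right[where a = 0] eventually_at_right_to_0[where a="- x"] algebra_simps)

text \<open>
  Multiplying out the difference quotient gives a form in which estimates can be added and chained
  along an interval.
\<close>

lemma left_derivative_iff:
  "(diff_quot U f x \<longlongrightarrow> l) (at_left 0) \<longleftrightarrow>
    (\<forall>e>0. \<forall>\<^sub>F y in at_left x. \<bar>f x - f y - l * (U x - U y)\<bar> \<le> e * (U x - U y))"
proof -
  have eq: "\<bar>f x - f (x + h) - l * (U x - U (x + h))\<bar> = \<bar>diff_quot U f x h - l\<bar> * (U x - U (x + h))"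
    if "h < 0" for h
  proof -
    have pos: "U x - U (x + h) > 0" using U_less[of "x + h" x] that by simp
    then have "f x - f (x + h) - l * (U x - U (x + h)) = (diff_quot U f x h - l) * (U x - U (x + h))"
      by (simp add: diff_quot_def field_simps)
    with pos show ?thesis by (simp add: abs_mult)
  qed
  have neg: "\<forall>\<^sub>F h in at_left (0::real). h < 0" by (simp add: eventually_at_filter)
  have conv: "(\<bar>f x - f (x + h) - l * (U x - U (x + h))\<bar> \<le> e * (U x - U (x + h))) \<longleftrightarrow> \<bar>diff_quot U f x h - l\<bar> \<le> e"
    if "h < 0" for h e
    using eq[OF that] U_less[of "x + h" x] that by simp
  have iff: "(\<forall>\<^sub>F y in at_left x. \<bar>f x - f y - l * (U x - U y)\<bar> \<le> e * (U x - U y)) \<longleftrightarrow>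
      (\<forall>\<^sub>F h in at_left 0. \<bar>diff_quot U f x h - l\<bar> \<le> e)" for e
    unfolding eventually_at_left_0[where x = x] by (rule eventually_cong[OF neg conv])
  show ?thesis
    unfolding iff tendsto_iff dist_real_def
  proof (intro iffI allI impI)
    fix e :: real assume "\<forall>e>0. \<forall>\<^sub>F h in at_left 0. \<bar>diff_quot U f x h - l\<bar> \<le> e" "e > 0"
    then have "\<forall>\<^sub>F h in at_left 0. \<bar>diff_quot U f x h - l\<bar> \<le> e/2" using half_gt_zero by blast
    then show "\<forall>\<^sub>F h in at_left 0. \<bar>diff_quot U f x h - l\<bar> < e"
      by eventually_elim (use \<open>e > 0\<close> in auto)
  qed (auto elim!: eventually_mono)
qed

lemma primitive_on_cell_derivative_in_cell:
  assumes f: "primitive_on_cell U c F f" and F: "caglad F" "integrable (cell_measure U c) F"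
    and x: "c < x" "x \<le> c + 1"
  shows "(diff_quot U f x \<longlongrightarrow> F x) (at_left 0)"
  unfolding left_derivative_iff
proof (intro allI impI)
  fix e :: real assume e: "e > 0"
  have "(F \<longlongrightarrow> F x) (at_left x)" using F by (simp add: caglad_def continuous_within)
  from tendstoD[OF this e] have "\<forall>\<^sub>F y in at_left x. \<bar>F y - F x\<bar> < e"
    by (simp add: dist_real_def)
  then obtain p where p: "p < x" "\<And>y. p < y \<Longrightarrow> y < x \<Longrightarrow> \<bar>F y - F x\<bar> < e"
    unfolding eventually_at_left_field by blast
  have "\<forall>\<^sub>F s in at_left x. s \<in> {max c p<..<x}"
    using x p by (intro eventually_at_left_real) auto
  then show "\<forall>\<^sub>F s in at_left x. \<bar>f x - f s - F x * (U x - U s)\<bar> \<le> e * (U x - U s)"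
  proof eventually_elim
    case (elim s)
    have s: "c \<le> s" "s < x" "p < s" using elim by auto
    have "\<bar>(LINT y:{s<..x}|cell_measure U c. F y) - F x * (U x - U s)\<bar> \<le> e * (U x - U s)"
    proof (rule integral_deviation_le[OF F(2)])
      show "\<bar>F y - F x\<bar> \<le> e" if "s < y" "y \<le> x" for y
        using p(2)[of y] s that e by (cases "y = x") auto
    qed (use s x in auto)
    moreover have "f x - f s = (LINT y:{s<..x}|cell_measure U c. F y)"
      using f s x by (simp add: primitive_on_cell_def)
    ultimately show ?case by simp
  qed
qed

lemma primitive_on_cell_derivative:
  assumes f: "periodic1 f" "primitive_on_cell U c F f"
    and F: "periodic1 F" "caglad F" "integrable (cell_measure U c) F"
  shows "(diff_quot U f x \<longlongrightarrow> F x) (at_left 0)"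
proof -
  define j where "j = \<lceil>x - c\<rceil> - 1"
  have j: "c < x + of_int (- j)" "x + of_int (- j) \<le> c + 1" unfolding j_def by simp_all linarith+
  from primitive_on_cell_derivative_in_cell[OF f(2) F(2,3) j] show ?thesis
    unfolding diff_quot_shift[OF f(1)] periodic1_shift[OF F(1)] .
qed

section \<open>The fundamental theorem for one-sided derivatives\<close>

text \<open>
  A continuous induction that moves to the left from \<open>b\<close>. Right-continuity of \<open>g\<close> and \<open>U\<close> shows that
  the infimum of the points reached so far is itself reached; the bound on the left of that point
  shows that it can be passed, unless it is \<open>a\<close>. This replaces the mean value theorem,
  which fails for discontinuous functions.
\<close>

lemma increments_le_from_left_derivative:
  fixes g :: "real \<Rightarrow> real"
  assumes "a \<le> b" and e: "e > 0"
    and right: "\<And>x. a \<le> x \<Longrightarrow> x < b \<Longrightarrow> (g \<longlongrightarrow> g x) (at_right x)"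
    and left: "\<And>x. a < x \<Longrightarrow> x \<le> b \<Longrightarrow> \<forall>\<^sub>F y in at_left x. \<bar>g x - g y\<bar> \<le> e * (U x - U y)"
  shows "\<bar>g b - g a\<bar> \<le> e * (U b - U a)"
proof -
  define S where "S = {x \<in> {a..b}. \<bar>g b - g x\<bar> \<le> e * (U b - U x)}"
  have bS: "b \<in> S" using assms(1) by (simp add: S_def)
  have bdd: "bdd_below S" by (auto simp: S_def bdd_below_def)
  define s where "s = Inf S"
  have s: "a \<le> s" "s \<le> b"
    unfolding s_def using bS bdd by (auto intro!: cInf_greatest cInf_lower) (simp add: S_def)
  have sS: "s \<in> S"
  proof (cases "s = b")
    case False
    with s have sb: "s < b" by simp
    show ?thesis
    proof (rule ccontr)
      assume nS: "s \<notin> S"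
      have "((\<lambda>y. e * (U b - U y) - \<bar>g b - g y\<bar>) \<longlongrightarrow> e * (U b - U s) - \<bar>g b - g s\<bar>) (at_right s)"
        using U_right[of s] right[OF s(1) sb] by (intro tendsto_intros) (auto simp: continuous_within)
      moreover have "e * (U b - U s) - \<bar>g b - g s\<bar> < 0"
        using nS s by (simp add: S_def)
      ultimately have "\<forall>\<^sub>F y in at_right s. e * (U b - U y) - \<bar>g b - g y\<bar> < 0"
        by (rule order_tendstoD(2))
      then obtain q where q: "s < q" "\<And>y. s < y \<Longrightarrow> y < q \<Longrightarrow> e * (U b - U y) - \<bar>g b - g y\<bar> < 0"
        unfolding eventually_at_right_field by blast
      have "\<exists>z\<in>S. z < q"
        using bS q(1) by (intro cInf_lessD) (auto simp: s_def)
      then obtain z where z: "z \<in> S" "z < q" by blast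
      then have "s \<le> z" unfolding s_def using bdd by (auto intro: cInf_lower)
      with z nS have "s < z" by (cases "s = z") auto
      from q(2)[OF this z(2)] z(1) show False by (simp add: S_def)
    qed
  qed (use bS in simp)
  have "s = a"
  proof (rule ccontr)
    assume "s \<noteq> a"
    with s have "a < s" by simp
    from left[OF this s(2)] obtain p where p: "p < s" "\<And>y. p < y \<Longrightarrow> y < s \<Longrightarrow> \<bar>g s - g y\<bar> \<le> e * (U s - U y)"
      unfolding eventually_at_left_field by blast
    define y where "y = (max a p + s) / 2"
    have y: "p < y" "y < s" "a \<le> y" using p(1) \<open>a < s\<close> by (auto simp: y_def)
    have "\<bar>g s - g y\<bar> \<le> e * U s - e * U y" "\<bar>g b - g s\<bar> \<le> e * U b - e * U s"
      using p(2)[OF y(1,2)] sS by (simp_all add: S_def right_diff_distrib)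
    then have "\<bar>g b - g y\<bar> \<le> e * (U b - U y)" unfolding right_diff_distrib by linarith
    then have "y \<in> S" using y s by (simp add: S_def)
    then have "s \<le> y" unfolding s_def using bdd by (rule cInf_lower)
    with y show False by simp
  qed
  with sS show ?thesis by (simp add: S_def)
qed

lemma constant_from_zero_left_derivative:
  fixes g :: "real \<Rightarrow> real"
  assumes "a \<le> b"
    and right: "\<And>x. a \<le> x \<Longrightarrow> x < b \<Longrightarrow> (g \<longlongrightarrow> g x) (at_right x)"
    and left: "\<And>x e. a < x \<Longrightarrow> x \<le> b \<Longrightarrow> e > 0 \<Longrightarrow> \<forall>\<^sub>F y in at_left x. \<bar>g x - g y\<bar> \<le> e * (U x - U y)"
  shows "g b = g a"
proof (rule ccontr)
  assume "g b \<noteq> g a"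
  then have ne: "\<bar>g b - g a\<bar> > 0" by simp
  define m where "m = U b - U a + 1"
  have m: "m > 0" using U_le[OF assms(1)] by (simp add: m_def)
  have "\<bar>g b - g a\<bar> / (2 * m) > 0" using ne m by simp
  from increments_le_from_left_derivative[OF assms(1) this right left[OF _ _ this]]
  have "\<bar>g b - g a\<bar> \<le> \<bar>g b - g a\<bar> / (2 * m) * (U b - U a)" .
  also have "\<dots> \<le> \<bar>g b - g a\<bar> / (2 * m) * m" using ne m by (intro mult_left_mono) (auto simp: m_def)
  also have "\<dots> = \<bar>g b - g a\<bar> / 2" using m by simp
  finally show False using ne by simp
qed

lemma integrable_caglad:
  assumes "caglad F" "periodic1 F"
  shows "integrable (cell_measure U c) F"
proof -
  from caglad_periodic_bounded[OF assms] obtain B where "\<And>x. \<bar>F x\<bar> \<le> B" by blast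
  then show ?thesis
    using borel_measurable_cell_measure[OF caglad_borel_measurable[OF assms(1)]]
    by (intro integrable_const_bound[where B = B] AE_I2) auto
qed

text \<open>
  The fundamental theorem: the integral of \<open>F\<close> has the same left derivative as \<open>f\<close>, so their difference
  has left derivative zero and is constant.
\<close>

lemma primitive_on_cell_from_left_derivative:
  assumes f: "cadlag f" and F: "caglad F" "periodic1 F"
    and deriv: "\<And>x. (diff_quot U f x \<longlongrightarrow> F x) (at_left 0)"
  shows "primitive_on_cell U c F f"
proof -
  let ?M = "cell_measure U c"
  note iF = integrable_caglad[OF F, of c]
  define J where "J t = (LINT x:{..t}|?M. F x)" for t
  have J0: "J c = 0"
    unfolding J_def set_lebesgue_integral_def
    by (subst Bochner_Integration.integral_cong[where g = "\<lambda>_. 0", OF refl]) (auto simp: space_cell_measure)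
  have J: "primitive_on_cell U c F J"
    by (intro primitive_on_cellI iF) (simp add: J0, simp add: J_def)
  have "f t - J t = f c - J c" if t: "c \<le> t" "t \<le> c + 1" for t
  proof (rule constant_from_zero_left_derivative[OF t(1), where g = "\<lambda>t. f t - J t"])
    fix x assume x: "c \<le> x" "x < t"
    have "(f \<longlongrightarrow> f x) (at_right x)" using f by (simp add: cadlag_def continuous_within)
    moreover have "(J \<longlongrightarrow> J x) (at_right x)"
      using primitive_on_cell_right_continuous[OF J iF] x t by simp
    ultimately show "((\<lambda>t. f t - J t) \<longlongrightarrow> f x - J x) (at_right x)" by (rule tendsto_diff)
  next
    fix x e :: real assume x: "c < x" "x \<le> t" and e: "e > 0"
    have "(diff_quot U J x \<longlongrightarrow> F x) (at_left 0)"
      using primitive_on_cell_derivative_in_cell[OF J F(1) iF] x t by simp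
    with deriv[of x] e
    have "\<forall>\<^sub>F y in at_left x. \<bar>f x - f y - F x * (U x - U y)\<bar> \<le> e/2 * (U x - U y)"
      "\<forall>\<^sub>F y in at_left x. \<bar>J x - J y - F x * (U x - U y)\<bar> \<le> e/2 * (U x - U y)"
      unfolding left_derivative_iff by (meson half_gt_zero)+
    then show "\<forall>\<^sub>F y in at_left x. \<bar>f x - J x - (f y - J y)\<bar> \<le> e * (U x - U y)"
    proof eventually_elim
      case (elim y)
      have "e * (U x - U y) = e/2 * (U x - U y) + e/2 * (U x - U y)" by simp
      with elim show ?case by linarith
    qed
  qed
  note key = this
  have eq: "f t - f s = J t - J s" if "c \<le> s" "s \<le> t" "t \<le> c + 1" for s t
    using key[of s] key[of t] that by simp
  with J show ?thesis by (simp add: primitive_on_cell_def)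
qed

text \<open>
  A nonzero value at \<open>x\<close> persists on some \<open>(s, x]\<close>, which has positive mass because \<open>U\<close> is
  strictly increasing.
\<close>

lemma caglad_eq_zero_if_AE:
  assumes f: "periodic1 f" "caglad f" and ae: "AE x in cell_measure U c. f x = 0"
  shows "f x = 0"
proof -
  have main: "f x = 0" if x: "c < x" "x \<le> c + 1" for x
  proof (rule ccontr)
    assume nz: "f x \<noteq> 0"
    have "(f \<longlongrightarrow> f x) (at_left x)" using f by (simp add: caglad_def continuous_within)
    then have "\<forall>\<^sub>F y in at_left x. f y \<noteq> 0"
      using nz by (rule tendsto_imp_eventually_ne)
    then obtain p where
      p: "p < x" "\<And>y. p < y \<Longrightarrow> y < x \<Longrightarrow> f y \<noteq> 0"
      unfolding eventually_at_left_field by blast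
    define s where "s = max c p"
    have s: "c \<le> s" "p \<le> s" "s < x" using x p by (auto simp: s_def)
    have ne: "f y \<noteq> 0" if "y \<in> {s<..x}" for y
      using p(2)[of y] nz that s by (cases "y = x") auto
    have "{s<..x} \<in> sets (cell_measure U c)"
      unfolding cell_measure_def sets_restrict_space using s x by auto
    then have "{s<..x} \<in> null_sets (cell_measure U c) \<longleftrightarrow> (AE y in cell_measure U c. y \<notin> {s<..x})"
      by (rule AE_iff_null_sets)
    moreover have "AE y in cell_measure U c. y \<notin> {s<..x}"
      using ae by eventually_elim (use ne in blast)
    ultimately have "emeasure (cell_measure U c) {s<..x} = 0"
      by (intro null_setsD1) simp
    with emeasure_cell[of c s x] s x U_less[of s x] show False by simp
  qed
  define j where "j = \<lceil>x - c\<rceil> - 1"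
  have j: "c < x + of_int (- j)" "x + of_int (- j) \<le> c + 1" unfolding j_def by simp_all linarith+
  from main[OF j] show ?thesis unfolding periodic1_shift[OF f(1)] .
qed

text \<open>
  The integral of \<open>u\<close> vanishes over all intervals \<open>(a, b]\<close>, hence over all Borel sets, since
  these intervals generate the Borel sets and are closed under intersection.
\<close>

lemma AE_zero_if_constant_primitive:
  assumes u: "integrable (cell_measure U c) u" and p: "primitive_on_cell U c u (\<lambda>_. a)"
  shows "AE x in cell_measure U c. u x = 0"
proof (rule density_zero[OF u])
  let ?M = "cell_measure U c"
  have i: "integrable ?M (\<lambda>x. indicator A x * u x)" if "A \<in> sets borel" for A
    by (rule set_integrable_cell[OF u that])
  have Ioc: "(LINT x:{a<..b}|?M. u x) = 0" for a b
  proof (cases "max a c \<le> min b (c + 1)")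
    case True
    have "(LINT x:{a<..b}|?M. u x) = (LINT x:{max a c<..min b (c + 1)}|?M. u x)"
      unfolding set_lebesgue_integral_def
      by (rule Bochner_Integration.integral_cong) (auto simp: space_cell_measure indicator_def)
    then show ?thesis using p True by (simp add: primitive_on_cell_def)
  next
    case False
    then show ?thesis
      unfolding set_lebesgue_integral_def
      by (subst Bochner_Integration.integral_cong[where g = "\<lambda>_. 0", OF refl])
        (auto simp: space_cell_measure indicator_def)
  qed
  have tot: "(\<integral>x. u x \<partial>?M) = 0"
  proof -
    have "(\<integral>x. u x \<partial>?M) = (LINT x:{c<..c+1}|?M. u x)"
      unfolding set_lebesgue_integral_def
      by (rule Bochner_Integration.integral_cong) (auto simp: space_cell_measure)
    then show ?thesis using Ioc by simp
  qed
  have borel: "(LINT x:A|?M. u x) = 0" if "A \<in> sets borel" for A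
  proof -
    let ?G = "range (\<lambda>(a, b). {a<..b::real})"
    have stable: "Int_stable ?G"
      by (auto simp: Int_stable_def Int_greaterThanAtMost)
    have gen: "A \<in> sigma_sets UNIV ?G"
      using that by (simp add: borel_sigma_sets_Ioc)
    show ?thesis
      using stable subset_UNIV[of ?G, folded Pow_UNIV] gen
    proof (induction rule: sigma_sets_induct_disjoint)
      case (compl A)
      then have A: "A \<in> sets borel" by (simp add: borel_sigma_sets_Ioc)
      have "(LINT x:UNIV - A|?M. u x) = (\<integral>x. u x - indicator A x * u x \<partial>?M)"
        unfolding set_lebesgue_integral_def
        by (rule Bochner_Integration.integral_cong) (auto simp: indicator_def)
      also have "\<dots> = 0"
        using i[OF A] u compl tot by (simp add: set_lebesgue_integral_def)
      finally show ?case .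
    next
      case (union A)
      then have A: "A n \<in> sets borel" for n by (auto simp: borel_sigma_sets_Ioc)
      have cell: "(LINT x:B|?M. u x) = (LINT x:B \<inter> {c<..c + 1}|?M. u x)" for B
        unfolding set_lebesgue_integral_def
        by (rule Bochner_Integration.integral_cong) (auto simp: space_cell_measure indicator_def)
      have "(LINT x:(\<Union>n. A n \<inter> {c<..c + 1})|?M. u x) = (\<Sum>n. LINT x:A n \<inter> {c<..c + 1}|?M. u x)"
      proof (rule lebesgue_integral_countable_add)
        show "A n \<inter> {c<..c + 1} \<in> sets ?M" for n
          unfolding cell_measure_def sets_restrict_space using A by (auto simp: Int_commute)
        show "A m \<inter> {c<..c + 1} \<inter> (A n \<inter> {c<..c + 1}) = {}" if "m \<noteq> n" for m n
          using union(1) that by (auto simp: disjoint_family_on_def)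
        have "(\<Union>n. A n \<inter> {c<..c + 1}) \<in> sets borel" using A by auto
        from i[OF this] show "set_integrable ?M (\<Union>n. A n \<inter> {c<..c + 1}) u"
          by (simp add: set_integrable_def)
      qed
      also have "\<dots> = 0" using union(3) by (simp only: cell[symmetric] suminf_zero)
      finally show ?case unfolding cell[of "\<Union>(range A)"] by simp
    next
      case (basic A)
      then show ?case using Ioc by auto
    next
      case empty
      show ?case by (simp add: set_lebesgue_integral_def)
    qed
  qed
  fix A assume "A \<in> sets ?M"
  then obtain A' where A': "A' \<in> sets borel" "A = {c<..c + 1} \<inter> A'"
    unfolding cell_measure_def sets_restrict_space by auto
  then have "A \<in> sets borel" by simp
  then show "(LINT x:A|?M. u x) = 0" by (rule borel)
qed

end

section \<open>Approximation by functions with a strong derivative\<close>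

locale left_integrator =
  fixes V :: "real \<Rightarrow> real"
  assumes strict: "strict_mono V" and caglad: "caglad V"
    and quasi: "\<And>x. V (x + 1) - V x = V 1 - V 0"
begin

lemma right_integrator_reflection: "right_integrator (\<lambda>x. - V (- x))"
proof
  show "strict_mono (\<lambda>x. - V (- x))" using strict by (simp add: strict_mono_def)
  show "cadlag (\<lambda>x. - V (- x))"
    using cadlag_neg[of "\<lambda>x. V (- x)"] caglad by (simp add: cadlag_uminus)
  show "- V (- (x + 1)) - - V (- x) = - V (- 1) - - V (- 0)" for x
    using quasi[of "- x - 1"] quasi[of "- 1"] by simp
qed

end

lemma left_integrator_reflection:
  assumes "right_integrator W"
  shows "left_integrator (\<lambda>x. - W (- x))"
proof
  interpret right_integrator W by fact
  show "strict_mono (\<lambda>x. - W (- x))" using strict by (simp add: strict_mono_def)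
  show "caglad (\<lambda>x. - W (- x))"
    using caglad_neg[of "\<lambda>x. W (- x)"] cadlag by (simp add: caglad_uminus)
  show "- W (- (x + 1)) - - W (- x) = - W (- 1) - - W (- 0)" for x
    using quasi[of "- x - 1"] quasi[of "- 1"] by simp
qed

context left_integrator
begin

text \<open>
  On the grid cell from \<open>k/N\<close> to \<open>(k+1)/N\<close> the approximation of \<open>x\<close> is affine in \<open>V\<close> and runs from
  \<open>x ((k-1)/N)\<close> to \<open>x (k/N)\<close>. It lags behind \<open>x\<close> by one cell on purpose: both values are then sampled
  strictly to the left of the current point, so that they converge to the value of a left-continuous
  \<open>x\<close>. Without the delay, the value at \<open>(k+1)/N\<close> could approach the right limit of \<open>x\<close> instead.
\<close>

definition slope :: "(real \<Rightarrow> real) \<Rightarrow> real \<Rightarrow> int \<Rightarrow> real" where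
  "slope x N k = (x (of_int k / N) - x (of_int (k - 1) / N)) / (V (of_int (k + 1) / N) - V (of_int k / N))"

definition piece :: "(real \<Rightarrow> real) \<Rightarrow> real \<Rightarrow> int \<Rightarrow> real \<Rightarrow> real" where
  "piece x N k t = x (of_int (k - 1) / N) + slope x N k * (V t - V (of_int k / N))"

definition delayed_interpolant :: "(real \<Rightarrow> real) \<Rightarrow> real \<Rightarrow> real \<Rightarrow> real" where
  "delayed_interpolant x N t = piece x N \<lfloor>N * t\<rfloor> t"

lemma grid_increment_pos: "N > 0 \<Longrightarrow> V (of_int (k + 1) / N) - V (of_int k / N) > 0"
  using strict by (simp add: strict_mono_less divide_strict_right_mono)

lemma piece_left_end: "piece x N k (of_int k / N) = x (of_int (k - 1) / N)"
  by (simp add: piece_def)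

lemma piece_right_end: "N > 0 \<Longrightarrow> piece x N k (of_int (k + 1) / N) = x (of_int k / N)"
  using grid_increment_pos[of N k] by (simp add: piece_def slope_def)

text \<open>
  Consecutive pieces agree at the grid point they share. The piece chosen by the ceiling is the one
  that governs the interpolant on a left neighbourhood of \<open>t\<close>.
\<close>

lemma delayed_interpolant_ceiling:
  assumes N: "N > 0"
  shows "delayed_interpolant x N t = piece x N (\<lceil>N * t\<rceil> - 1) t"
proof (cases "N * t \<in> \<int>")
  case True
  then obtain k where k: "N * t = of_int k" by (auto elim: Ints_cases)
  then have t: "t = of_int k / N" using N by (simp add: field_simps)
  show ?thesis
    unfolding delayed_interpolant_def k t
    using N piece_left_end[of x N k] piece_right_end[OF N, of x "k - 1"] by simp
next
  case False
  then have "\<lceil>N * t\<rceil> - 1 = \<lfloor>N * t\<rfloor>" 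
    by (simp add: ceiling_altdef) (metis Ints_of_int)
  then show ?thesis by (simp add: delayed_interpolant_def)
qed

lemma eventually_floor_at_right:
  fixes N t :: real
  assumes N: "N > 0"
  shows "\<forall>\<^sub>F y in at_right t. \<lfloor>N * y\<rfloor> = \<lfloor>N * t\<rfloor>"
proof -
  have "t < of_int (\<lfloor>N * t\<rfloor> + 1) / N"
    using N floor_correct[of "N * t"] by (simp add: less_divide_eq mult.commute)
  from eventually_at_right_real[OF this] show ?thesis
  proof eventually_elim
    case (elim y)
    have "N * t \<le> N * y" using elim N by simp
    moreover have "N * y < of_int (\<lfloor>N * t\<rfloor> + 1)" using elim N by (simp add: less_divide_eq mult.commute)
    ultimately show ?case using floor_correct[of "N * t"] by (intro floor_unique) linarith+
  qed
qed

lemma eventually_floor_ceiling_at_left: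
  fixes N t :: real
  assumes N: "N > 0"
  shows "\<forall>\<^sub>F y in at_left t. \<lfloor>N * y\<rfloor> = \<lceil>N * t\<rceil> - 1 \<and> \<lceil>N * y\<rceil> = \<lceil>N * t\<rceil>"
proof -
  have "of_int (\<lceil>N * t\<rceil> - 1) / N < t"
    using N ceiling_correct[of "N * t"] by (simp add: divide_less_eq mult.commute)
  from eventually_at_left_real[OF this] show ?thesis
  proof eventually_elim
    case (elim y)
    have "N * y < N * t" using elim N by simp
    moreover have "of_int (\<lceil>N * t\<rceil> - 1) < N * y" using elim N by (simp add: divide_less_eq mult.commute)
    ultimately show ?case using ceiling_correct[of "N * t"]
      by (intro conjI floor_unique ceiling_unique) linarith+
  qed
qed

lemma delayed_interpolant_caglad:
  assumes N: "N > 0"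
  shows "caglad (delayed_interpolant x N)"
  unfolding caglad_def continuous_within
proof (intro allI conjI)
  fix t
  let ?k = "\<lceil>N * t\<rceil> - 1"
  have "((\<lambda>y. piece x N ?k y) \<longlongrightarrow> piece x N ?k t) (at_left t)"
    unfolding piece_def using caglad by (intro tendsto_intros) (auto simp: caglad_def continuous_within)
  moreover have "\<forall>\<^sub>F y in at_left t. piece x N ?k y = delayed_interpolant x N y"
    using eventually_floor_ceiling_at_left[OF N, of t]
    by eventually_elim (simp add: delayed_interpolant_def)
  ultimately show "(delayed_interpolant x N \<longlongrightarrow> delayed_interpolant x N t) (at_left t)"
    unfolding delayed_interpolant_ceiling[OF N, of x t] by (rule Lim_transform_eventually)
  from caglad obtain l where "(V \<longlongrightarrow> l) (at_right t)" unfolding caglad_def by blast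
  then have "((\<lambda>y. piece x N \<lfloor>N * t\<rfloor> y) \<longlongrightarrow> x (of_int (\<lfloor>N * t\<rfloor> - 1) / N) + slope x N \<lfloor>N * t\<rfloor> * (l - V (of_int \<lfloor>N * t\<rfloor> / N))) (at_right t)"
    unfolding piece_def by (intro tendsto_intros)
  moreover have "\<forall>\<^sub>F y in at_right t. piece x N \<lfloor>N * t\<rfloor> y = delayed_interpolant x N y"
    using eventually_floor_at_right[OF N, of t] by eventually_elim (simp add: delayed_interpolant_def)
  ultimately show "\<exists>l. (delayed_interpolant x N \<longlongrightarrow> l) (at_right t)"
    using Lim_transform_eventually by blast
qed

lemma slope_cadlag:
  assumes N: "N > 0"
  shows "cadlag (\<lambda>t. slope x N \<lfloor>N * t\<rfloor>)"
  unfolding cadlag_def continuous_within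
proof (intro allI conjI)
  fix t
  have "\<forall>\<^sub>F y in at_right t. slope x N \<lfloor>N * y\<rfloor> = slope x N \<lfloor>N * t\<rfloor>"
    using eventually_floor_at_right[OF N, of t] by eventually_elim simp
  then show "((\<lambda>t. slope x N \<lfloor>N * t\<rfloor>) \<longlongrightarrow> slope x N \<lfloor>N * t\<rfloor>) (at_right t)"
    by (rule tendsto_eventually)
  have "\<forall>\<^sub>F y in at_left t. slope x N \<lfloor>N * y\<rfloor> = slope x N (\<lceil>N * t\<rceil> - 1)"
    using eventually_floor_ceiling_at_left[OF N, of t] by eventually_elim simp
  then show "\<exists>l. ((\<lambda>t. slope x N \<lfloor>N * t\<rfloor>) \<longlongrightarrow> l) (at_left t)"
    by (intro exI) (rule tendsto_eventually)
qed

lemma delayed_interpolant_derivative: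
  assumes N: "N > 0"
  shows "(diff_quot V (delayed_interpolant x N) t \<longlongrightarrow> slope x N \<lfloor>N * t\<rfloor>) (at_right 0)"
proof (rule tendsto_eventually)
  have "\<forall>\<^sub>F h in at_right 0. \<lfloor>N * (h + t)\<rfloor> = \<lfloor>N * t\<rfloor>"
    using eventually_floor_at_right[OF N, of t] unfolding eventually_at_right_to_0[where a = t] .
  moreover have "\<forall>\<^sub>F h in at_right (0::real). 0 < h" by (simp add: eventually_at_filter)
  ultimately show "\<forall>\<^sub>F h in at_right 0. diff_quot V (delayed_interpolant x N) t h = slope x N \<lfloor>N * t\<rfloor>"
  proof eventually_elim
    case (elim h)
    have "V (t + h) - V t > 0" using strict elim by (simp add: strict_mono_less)
    with elim show ?case
      by (simp add: diff_quot_def delayed_interpolant_def piece_def add.commute right_diff_distrib[symmetric])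
  qed
qed

lemma
  assumes per: "periodic1 x" and N: "N = real (Suc n)"
  shows slope_periodic: "periodic1 (\<lambda>t. slope x N \<lfloor>N * t\<rfloor>)"
    and delayed_interpolant_periodic: "periodic1 (delayed_interpolant x N)"
proof -
  have N0: "N > 0" using N by simp
  have fl: "\<lfloor>N * (t + 1)\<rfloor> = \<lfloor>N * t\<rfloor> + int (Suc n)" for t
    unfolding N using floor_add_int[of "real (Suc n) * t" "int (Suc n)"]
    by (simp add: distrib_left del: of_nat_Suc)
  have grid: "of_int (k + int (Suc n)) / N = of_int k / N + of_int 1" for k
    using N0 unfolding N by (simp add: add_divide_distrib del: of_nat_Suc)
  have xs: "x (of_int (k + int (Suc n)) / N) = x (of_int k / N)" for k
    unfolding grid by (rule periodic1_shift[OF per])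
  have Vs: "V (of_int (k + int (Suc n)) / N) = V (of_int k / N) + (V 1 - V 0)" for k
    unfolding grid using quasi[of "of_int k / N"] by simp
  have sl: "slope x N (k + int (Suc n)) = slope x N k" for k
    unfolding slope_def
    using xs[of k] xs[of "k - 1"] Vs[of k] Vs[of "k + 1"] by (simp add: algebra_simps)
  show "periodic1 (\<lambda>t. slope x N \<lfloor>N * t\<rfloor>)"
    unfolding periodic1_def fl sl by simp
  have "piece x N (k + int (Suc n)) (t + 1) = piece x N k t" for k t
    unfolding piece_def sl Vs using xs[of "k - 1"] quasi[of t] by (simp add: algebra_simps)
  then show "periodic1 (delayed_interpolant x N)"
    unfolding periodic1_def delayed_interpolant_def fl by simp
qed

text \<open>
  On its grid cell, a piece is a convex combination of its two end values.
\<close>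

lemma piece_between:
  assumes N: "N > 0" and t: "of_int k / N \<le> t" "t \<le> of_int (k + 1) / N"
    and b: "\<bar>x (of_int (k - 1) / N) - a\<bar> \<le> e" "\<bar>x (of_int k / N) - a\<bar> \<le> e"
  shows "\<bar>piece x N k t - a\<bar> \<le> e"
proof -
  define d where "d = V (of_int (k + 1) / N) - V (of_int k / N)"
  have d: "d > 0" unfolding d_def by (rule grid_increment_pos[OF N])
  define r where "r = (V t - V (of_int k / N)) / d"
  have "V (of_int k / N) \<le> V t" "V t \<le> V (of_int (k + 1) / N)"
    using t strict by (simp_all add: strict_mono_less_eq)
  then have r: "0 \<le> r" "r \<le> 1" using d by (simp_all add: r_def d_def)
  have "piece x N k t - a = (1 - r) * (x (of_int (k - 1) / N) - a) + r * (x (of_int k / N) - a)"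
    unfolding piece_def slope_def d_def[symmetric] r_def using d by (simp add: field_simps)
  also have "\<bar>\<dots>\<bar> \<le> (1 - r) * e + r * e"
    using r b by (intro order_trans[OF abs_triangle_ineq] add_mono) (auto simp: abs_mult intro!: mult_left_mono)
  finally show ?thesis by (simp add: algebra_simps)
qed

lemma caglad_approximation:
  assumes x: "caglad x" "periodic1 x"
  obtains z h :: "nat \<Rightarrow> real \<Rightarrow> real" and B where
    "\<And>n. caglad (z n)" "\<And>n. periodic1 (z n)" "\<And>n. cadlag (h n)" "\<And>n. periodic1 (h n)"
    "\<And>n t. (diff_quot V (z n) t \<longlongrightarrow> h n t) (at_right 0)"
    "\<And>n t. \<bar>z n t\<bar> \<le> B" "\<And>t. (\<lambda>n. z n t) \<longlonglongrightarrow> x t"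
proof -
  from caglad_periodic_bounded[OF x] obtain B where B: "\<And>t. \<bar>x t\<bar> \<le> B" by blast
  define N where "N n = real (Suc n)" for n
  have N: "N n > 0" for n by (simp add: N_def)
  have cell: "of_int (\<lceil>N n * t\<rceil> - 1) / N n \<le> t" "t \<le> of_int (\<lceil>N n * t\<rceil> - 1 + 1) / N n" for n t
    using N[of n] ceiling_correct[of "N n * t"]
    by (simp_all add: divide_le_eq le_divide_eq mult.commute)
  show ?thesis
  proof (rule that[of "\<lambda>n. delayed_interpolant x (N n)" "\<lambda>n t. slope x (N n) \<lfloor>N n * t\<rfloor>" B])
    fix n t
    show "caglad (delayed_interpolant x (N n))" by (rule delayed_interpolant_caglad[OF N])
    show "periodic1 (delayed_interpolant x (N n))" by (rule delayed_interpolant_periodic[OF x(2) N_def])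
    show "cadlag (\<lambda>t. slope x (N n) \<lfloor>N n * t\<rfloor>)" by (rule slope_cadlag[OF N])
    show "periodic1 (\<lambda>t. slope x (N n) \<lfloor>N n * t\<rfloor>)" by (rule slope_periodic[OF x(2) N_def])
    show "(diff_quot V (delayed_interpolant x (N n)) t \<longlongrightarrow> slope x (N n) \<lfloor>N n * t\<rfloor>) (at_right 0)"
      by (rule delayed_interpolant_derivative[OF N])
    show "\<bar>delayed_interpolant x (N n) t\<bar> \<le> B"
      unfolding delayed_interpolant_ceiling[OF N]
      using piece_between[OF N cell, of x n t 0 B] B by simp
  next
    fix t
    have "(x \<longlongrightarrow> x t) (at_left t)" using x by (simp add: caglad_def continuous_within)
    from filterlim_compose[OF this ceiling_grid_at_left[of 0 t]] filterlim_compose[OF this ceiling_grid_at_left[of 1 t]]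
    have lim: "(\<lambda>n. x (of_int (\<lceil>N n * t\<rceil> - 1) / N n)) \<longlonglongrightarrow> x t"
      "(\<lambda>n. x (of_int (\<lceil>N n * t\<rceil> - 1 - 1) / N n)) \<longlonglongrightarrow> x t"
      by (simp_all add: N_def)
    show "(\<lambda>n. delayed_interpolant x (N n) t) \<longlonglongrightarrow> x t"
    proof (rule tendstoI)
      fix e :: real assume e: "e > 0"
      from tendstoD[OF lim(1), of "e/2"] tendstoD[OF lim(2), of "e/2"] e
      have "\<forall>\<^sub>F n in sequentially. dist (x (of_int (\<lceil>N n * t\<rceil> - 1) / N n)) (x t) < e/2"
        "\<forall>\<^sub>F n in sequentially. dist (x (of_int (\<lceil>N n * t\<rceil> - 1 - 1) / N n)) (x t) < e/2" by simp_all
      then show "\<forall>\<^sub>F n in sequentially. dist (delayed_interpolant x (N n) t) (x t) < e"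
      proof eventually_elim
        case (elim n)
        then have "\<bar>piece x (N n) (\<lceil>N n * t\<rceil> - 1) t - x t\<bar> \<le> e/2"
          by (intro piece_between[OF N cell]) (auto simp: dist_real_def)
        then show ?case unfolding delayed_interpolant_ceiling[OF N] dist_real_def using e by simp
      qed
    qed
  qed
qed

end

section \<open>Two integrators on the torus\<close>

text \<open>
  The left-continuous integrator \<open>V\<close> is handled through the right-continuous integrator
  \<open>\<lambda>x. - V (- x)\<close> on the cell \<open>(-1, 0]\<close>.
\<close>

locale torus_pair = W: right_integrator W + V: left_integrator V for W V
begin

sublocale R: right_integrator "\<lambda>x. - V (- x)"
  by (rule V.right_integrator_reflection)

abbreviation (input) "V_cell \<equiv> cell_measure (\<lambda>x. - V (- x)) (- 1)"

lemma dW_eq_cell: "dW_torus W = cell_measure W 0"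
  by (simp add: dW_torus_def cell_measure_def)

lemma space_dV: "space (dV_torus V) = {0..<1}"
  by (simp add: dV_torus_def left_interval_measure_def space_restrict_space)

lemma measurable_reflection: "uminus \<in> measurable V_cell (dV_torus V)"
  unfolding dV_torus_def cell_measure_def left_interval_measure_def
  by (rule measurable_restrict_space3) auto

lemma dV_eq_distr: "dV_torus V = distr V_cell (dV_torus V) uminus"
proof (rule measure_eqI)
  fix A assume A: "A \<in> sets (dV_torus V)"
  then obtain B where B: "B \<in> sets borel" "A = {0..<1} \<inter> B"
    unfolding dV_torus_def sets_restrict_space left_interval_measure_def by auto
  then have Ab: "A \<in> sets borel" and sub: "A \<subseteq> {0..<1}" by auto
  have pre: "uminus -` A \<in> sets borel"
    using measurable_sets[of uminus borel borel A] Ab by simp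
  have "emeasure (dV_torus V) A = emeasure (interval_measure (\<lambda>x. - V (- x))) (uminus -` A)"
    unfolding dV_torus_def left_interval_measure_def
    using Ab sub by (subst emeasure_restrict_space) (auto simp: emeasure_distr)
  also have "\<dots> = emeasure V_cell (uminus -` A)"
    unfolding cell_measure_def using sub pre by (subst emeasure_restrict_space) auto
  also have "uminus -` A = uminus -` A \<inter> space V_cell"
    using sub by (auto simp: space_cell_measure)
  finally show "emeasure (dV_torus V) A = emeasure (distr V_cell (dV_torus V) uminus) A"
    using A by (simp add: emeasure_distr[OF measurable_reflection])
qed simp

lemma integral_dV:
  fixes f :: "real \<Rightarrow> real"
  assumes "f \<in> borel_measurable (dV_torus V)"
  shows "(\<integral>x. f x \<partial>dV_torus V) = (\<integral>x. f (- x) \<partial>V_cell)"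
  by (subst dV_eq_distr) (rule integral_distr[OF measurable_reflection assms])

lemma integrable_dV:
  fixes f :: "real \<Rightarrow> real"
  assumes "f \<in> borel_measurable (dV_torus V)"
  shows "integrable (dV_torus V) f \<longleftrightarrow> integrable V_cell (\<lambda>x. f (- x))"
  by (subst dV_eq_distr) (rule integrable_distr_eq[OF measurable_reflection assms])

lemma AE_dV:
  assumes "{x \<in> space (dV_torus V). P x} \<in> sets (dV_torus V)"
  shows "(AE x in dV_torus V. P x) \<longleftrightarrow> (AE x in V_cell. P (- x))"
  by (subst dV_eq_distr) (rule AE_distr_iff[OF measurable_reflection assms])

lemma borel_measurable_dV: "f \<in> borel_measurable borel \<Longrightarrow> f \<in> borel_measurable (dV_torus V)"
  unfolding dV_torus_def left_interval_measure_def by (rule measurable_restrict_space1) simp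

sublocale dV: finite_measure "dV_torus V"
proof -
  have "finite_measure (distr V_cell (dV_torus V) uminus)"
    by (rule R.finite_measure_distr[OF measurable_reflection])
  then show "finite_measure (dV_torus V)" by (simp only: dV_eq_distr[symmetric])
qed

text \<open>
  From here on a truth value selects the side: \<open>True\<close> stands for \<open>W\<close>, its measure and caglad functions,
  \<open>False\<close> for \<open>V\<close>, its measure and cadlag functions. A primitive of a function on side \<open>b\<close>, and
  likewise a function differentiated with respect to the integrator of side \<open>b\<close>, lives on side \<open>\<not> b\<close>.
  The alternation of the two derivatives thus becomes negation, and each statement below covers both
  roles of \<open>W\<close> and \<open>V\<close>.
\<close>

definition mu :: "bool \<Rightarrow> real measure" where
  "mu b = (if b then dW_torus W else dV_torus V)"

definition regulated :: "bool \<Rightarrow> (real \<Rightarrow> real) set" where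
  "regulated b = {f. periodic1 f \<and> (if b then caglad f else cadlag f)}"

definition primitive :: "bool \<Rightarrow> (real \<Rightarrow> real) \<Rightarrow> (real \<Rightarrow> real) \<Rightarrow> bool" where
  "primitive b F f \<longleftrightarrow> periodic1 f \<and> (\<forall>s t. 0 \<le> s \<longrightarrow> s \<le> t \<longrightarrow> t \<le> 1 \<longrightarrow>
     f t - f s = (if b then LINT x:{s<..t}|mu b. F x else LINT x:{s..<t}|mu b. F x))"

definition strong_deriv :: "bool \<Rightarrow> (real \<Rightarrow> real) \<Rightarrow> (real \<Rightarrow> real) \<Rightarrow> bool" where
  "strong_deriv b f F \<longleftrightarrow> (\<forall>x. if b then (diff_quot W f x \<longlongrightarrow> F x) (at_left 0)
                             else (diff_quot V f x \<longlongrightarrow> F x) (at_right 0))"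

sublocale mu: finite_measure "mu b" for b
  unfolding mu_def by (cases b) (simp_all add: dW_eq_cell W.finite_measure_axioms dV.finite_measure_axioms)

lemma borel_measurable_mu: "f \<in> borel_measurable borel \<Longrightarrow> f \<in> borel_measurable (mu b)"
  by (cases b) (simp_all add: mu_def dW_eq_cell borel_measurable_cell_measure borel_measurable_dV)

lemma integrable_indicator_mu:
  fixes F :: "real \<Rightarrow> real"
  assumes F: "integrable (mu b) F" and A: "A \<in> sets borel"
  shows "integrable (mu b) (\<lambda>x. indicator A x * F x)"
proof (rule Bochner_Integration.integrable_bound[OF F])
  have "(indicator A :: real \<Rightarrow> real) \<in> borel_measurable (mu b)" using A by (intro borel_measurable_mu) simp
  then show "(\<lambda>x. indicator A x * F x) \<in> borel_measurable (mu b)" using F by (intro borel_measurable_times) auto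
qed (auto simp: indicator_def)

lemma space_mu: "space (mu b) = (if b then {0<..1} else {0..<1})"
  by (simp add: mu_def dW_eq_cell space_cell_measure space_dV)

lemma mu_space_pos: "measure (mu b) (space (mu b)) > 0"
proof (cases b)
  case True
  then show ?thesis
    using W.measure_cell_space[of 0] W.U_less[of 0 1] by (simp add: mu_def dW_eq_cell)
next
  case False
  have "measure (dV_torus V) (space (dV_torus V)) = measure (distr V_cell (dV_torus V) uminus) (space (dV_torus V))"
    by (rule arg_cong[OF dV_eq_distr, of "\<lambda>M. measure M (space (dV_torus V))"])
  also have "\<dots> = measure V_cell (uminus -` space (dV_torus V) \<inter> space V_cell)"
    by (rule measure_distr[OF measurable_reflection]) simp
  also have "uminus -` space (dV_torus V) \<inter> space V_cell = space V_cell"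
    by (auto simp: space_dV space_cell_measure)
  finally show ?thesis
    using False R.measure_cell_space[of "-1"] R.U_less[of "-1" 0] by (simp add: mu_def)
qed

lemma mu_True: "mu True = cell_measure W 0" and mu_False: "mu False = dV_torus V"
  by (simp_all add: mu_def dW_eq_cell)

lemma primitive_True: "primitive True F f \<longleftrightarrow> periodic1 f \<and> primitive_on_cell W 0 F f"
  by (simp add: primitive_def primitive_on_cell_def mu_def dW_eq_cell)

text \<open>
  The sign comes from the reflection, which reverses the direction of integration.
\<close>

lemma primitive_False:
  assumes "F \<in> borel_measurable (mu False)"
  shows "primitive False F f \<longleftrightarrow>
    periodic1 f \<and> primitive_on_cell (\<lambda>x. - V (- x)) (- 1) (\<lambda>x. F (- x)) (\<lambda>x. - f (- x))"
proof -
  have m: "F \<in> borel_measurable (dV_torus V)" using assms by (simp add: mu_def)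
  have eq: "(LINT x:{s..<t}|dV_torus V. F x) = (LINT x:{-t<..-s}|V_cell. F (- x))" for s t
  proof -
    have "(indicator {s..<t} :: real \<Rightarrow> real) \<in> borel_measurable (dV_torus V)"
      by (intro borel_measurable_dV) simp
    then have "(\<lambda>x. indicator {s..<t} x *\<^sub>R F x) \<in> borel_measurable (dV_torus V)"
      using m by (intro borel_measurable_scaleR)
    from integral_dV[OF this] show ?thesis
      unfolding set_lebesgue_integral_def
      by (simp, intro Bochner_Integration.integral_cong) (auto simp: indicator_def)
  qed
  have "(\<forall>s t. 0 \<le> s \<longrightarrow> s \<le> t \<longrightarrow> t \<le> 1 \<longrightarrow> f t - f s = (LINT x:{-t<..-s}|V_cell. F (- x))) \<longleftrightarrow>
        (\<forall>s t. -1 \<le> s \<longrightarrow> s \<le> t \<longrightarrow> t \<le> 0 \<longrightarrow> - f (- t) - - f (- s) = (LINT x:{s<..t}|V_cell. F (- x)))"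
    (is "?L \<longleftrightarrow> ?R")
  proof
    assume L: ?L
    show ?R
    proof (intro allI impI)
      fix s t :: real assume "-1 \<le> s" "s \<le> t" "t \<le> 0"
      with L[rule_format, of "-t" "-s"] show "- f (- t) - - f (- s) = (LINT x:{s<..t}|V_cell. F (- x))" by simp
    qed
  next
    assume R: ?R
    show ?L
    proof (intro allI impI)
      fix s t :: real assume "0 \<le> s" "s \<le> t" "t \<le> 1"
      with R[rule_format, of "-t" "-s"] show "f t - f s = (LINT x:{-t<..-s}|V_cell. F (- x))" by simp
    qed
  qed
  then show ?thesis
    unfolding primitive_def primitive_on_cell_def by (simp add: mu_def eq)
qed

lemma strong_deriv_True: "strong_deriv True f F \<longleftrightarrow> (\<forall>x. (diff_quot W f x \<longlongrightarrow> F x) (at_left 0))"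
  by (simp add: strong_deriv_def)

lemma strong_deriv_False:
  "strong_deriv False f F \<longleftrightarrow> (\<forall>x. (diff_quot (\<lambda>x. - V (- x)) (\<lambda>x. - f (- x)) x \<longlongrightarrow> F (- x)) (at_left 0))"
proof -
  have dq: "diff_quot (\<lambda>x. - V (- x)) (\<lambda>x. - f (- x)) x = (\<lambda>h. diff_quot V f (- x) (- h))" for x
  proof
    fix h
    have "diff_quot (\<lambda>x. - V (- x)) (\<lambda>x. - f (- x)) x h = (- (f (- x + - h) - f (- x))) / (- (V (- x + - h) - V (- x)))"
      by (simp add: diff_quot_def)
    moreover have "(- p) / (- q) = p / q" for p q :: real by simp
    ultimately show "diff_quot (\<lambda>x. - V (- x)) (\<lambda>x. - f (- x)) x h = diff_quot V f (- x) (- h)"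
      by (simp only: diff_quot_def)
  qed
  have "(diff_quot (\<lambda>x. - V (- x)) (\<lambda>x. - f (- x)) x \<longlongrightarrow> l) (at_left 0) \<longleftrightarrow> (diff_quot V f (- x) \<longlongrightarrow> l) (at_right 0)" for x l
    unfolding dq by (simp add: filterlim_at_left_to_right[where a = 0])
  moreover have "(\<forall>x. P x) \<longleftrightarrow> (\<forall>x. P (- x))" for P :: "real \<Rightarrow> bool"
    by (metis minus_minus)
  from this[of "\<lambda>x. (diff_quot V f x \<longlongrightarrow> F x) (at_right 0)"]
  have "(\<forall>x. (diff_quot V f x \<longlongrightarrow> F x) (at_right 0)) \<longleftrightarrow> (\<forall>x. (diff_quot V f (- x) \<longlongrightarrow> F (- x)) (at_right 0))" .
  ultimately show ?thesis unfolding strong_deriv_def by simp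
qed

lemma regulated_True: "f \<in> regulated True \<longleftrightarrow> periodic1 f \<and> caglad f"
  by (simp add: regulated_def)

lemma regulated_False: "f \<in> regulated False \<longleftrightarrow> periodic1 (\<lambda>x. f (- x)) \<and> caglad (\<lambda>x. f (- x))"
  by (simp add: regulated_def periodic1_uminus caglad_uminus)

lemma regulated_periodic: "f \<in> regulated b \<Longrightarrow> periodic1 f"
  by (simp add: regulated_def)

lemma regulated_diff: "f \<in> regulated b \<Longrightarrow> g \<in> regulated b \<Longrightarrow> (\<lambda>x. f x - g x) \<in> regulated b"
  by (auto simp: regulated_def periodic1_def caglad_diff cadlag_diff)

lemma regulated_const: "(\<lambda>_. a) \<in> regulated b"
  by (auto simp: regulated_def periodic1_def caglad_const cadlag_const)

lemma regulated_bounded: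
  assumes "f \<in> regulated b"
  obtains B where "B > 0" "\<And>x. \<bar>f x\<bar> \<le> B"
proof (cases b)
  case True
  with assms show ?thesis using that caglad_periodic_bounded by (auto simp: regulated_True)
next
  case False
  with assms obtain B where B: "B > 0" "\<And>x. \<bar>f (- x)\<bar> \<le> B"
    using caglad_periodic_bounded[of "\<lambda>x. f (- x)"] by (auto simp: regulated_False)
  show ?thesis using that[OF B(1)] B(2)[of "- _"] by simp
qed

lemma regulated_borel: "f \<in> regulated b \<Longrightarrow> f \<in> borel_measurable borel"
proof (cases b)
  case False
  assume "f \<in> regulated b"
  with False have "(\<lambda>x. f (- x)) \<in> borel_measurable borel"
    by (simp add: regulated_False caglad_borel_measurable)
  from measurable_compose[OF borel_measurable_uminus[OF measurable_ident] this]
  show ?thesis by simp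
qed (auto simp: regulated_True caglad_borel_measurable)

lemma regulated_integrable:
  assumes f: "f \<in> regulated b"
  shows "integrable (mu c) f"
proof -
  from regulated_bounded[OF f] obtain B where "\<And>x. \<bar>f x\<bar> \<le> B" by blast
  then show ?thesis
    using borel_measurable_mu[OF regulated_borel[OF f]]
    by (intro mu.integrable_const_bound[where B = B] AE_I2) auto
qed

lemma regulated_times_integrable:
  assumes f: "f \<in> regulated b" and u: "integrable (mu c) u"
  shows "integrable (mu c) (\<lambda>x. f x * u x)"
proof -
  from regulated_bounded[OF f] obtain B where B: "B > 0" "\<And>x. \<bar>f x\<bar> \<le> B" by blast
  have "integrable (mu c) (\<lambda>x. B * u x)" using u by simp
  moreover have "(\<lambda>x. f x * u x) \<in> borel_measurable (mu c)"
    using borel_measurable_mu[OF regulated_borel[OF f]] u by (intro borel_measurable_times) auto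
  ultimately show ?thesis
    by (rule Bochner_Integration.integrable_bound) (use B in \<open>auto simp: abs_mult intro!: mult_right_mono\<close>)
qed

lemma regulated_uniform_limit:
  assumes "\<And>n::nat. f n \<in> regulated b" "uniform_limit UNIV f g sequentially"
  shows "g \<in> regulated b"
proof -
  have main: "periodic1 g \<and> caglad g"
    if "\<And>n::nat. periodic1 (f n) \<and> caglad (f n)" "uniform_limit UNIV f g sequentially" for f g
  proof
    show "caglad g" using that by (intro caglad_uniform_limit[of f g]) auto
    show "periodic1 g"
      unfolding periodic1_def
    proof
      fix x
      have "(\<lambda>n. f n (x + 1)) \<longlonglongrightarrow> g (x + 1)" "(\<lambda>n. f n x) \<longlonglongrightarrow> g x"
        using tendsto_uniform_limitI[OF that(2)] by auto
      moreover have "f n (x + 1) = f n x" for n using that(1)[of n] by (simp add: periodic1_def)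
      ultimately show "g (x + 1) = g x" using LIMSEQ_unique by simp
    qed
  qed
  show ?thesis
  proof (cases b)
    case True
    with main[of f g] assms show ?thesis by (simp add: regulated_True)
  next
    case False
    have "uniform_limit UNIV (\<lambda>n x. f n (- x)) (\<lambda>x. g (- x)) sequentially"
      using assms(2) by (rule uniform_limit_compose') auto
    with main[of "\<lambda>n x. f n (- x)" "\<lambda>x. g (- x)"] assms(1) False show ?thesis by (simp add: regulated_False)
  qed
qed

lemma primitive_exists:
  assumes F: "integrable (mu b) F" and mean: "(\<integral>x. F x \<partial>mu b) = 0"
  shows "\<exists>f. primitive b F f"
proof (cases b)
  case True
  then show ?thesis
    using W.periodic_primitive_exists[of 0 F] F mean by (simp add: primitive_True mu_def dW_eq_cell)
next
  case False
  have m: "F \<in> borel_measurable (dV_torus V)" using F False by (auto simp: mu_def)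
  have "integrable V_cell (\<lambda>x. F (- x))" "(\<integral>x. F (- x) \<partial>V_cell) = 0"
    using integrable_dV[OF m] integral_dV[OF m] F mean False by (simp_all add: mu_def)
  then obtain g where g: "periodic1 g" "primitive_on_cell (\<lambda>x. - V (- x)) (- 1) (\<lambda>x. F (- x)) g"
    using R.periodic_primitive_exists by blast
  have "periodic1 (\<lambda>x. - g (- x))"
    using g(1) periodic1_uminus[of g] by (simp add: periodic1_def)
  then have "primitive False F (\<lambda>x. - g (- x))"
    using m g(2) by (subst primitive_False) (simp_all add: mu_def)
  with False show ?thesis by (intro exI[of _ "\<lambda>x. - g (- x)"]) simp
qed

lemma primitive_regulated:
  assumes "primitive b F f" "integrable (mu b) F"
  shows "f \<in> regulated (\<not> b)"
proof (cases b)
  case True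
  then show ?thesis
    using W.primitive_on_cell_cadlag[of f 0 F] assms by (auto simp: primitive_True regulated_def mu_def dW_eq_cell)
next
  case False
  have m: "F \<in> borel_measurable (mu False)" using assms False by auto
  have "integrable V_cell (\<lambda>x. F (- x))"
    using m assms False integrable_dV by (simp add: mu_def)
  moreover have "periodic1 (\<lambda>x. - f (- x))"
    using assms False periodic1_uminus[of f] by (simp add: primitive_def periodic1_def)
  ultimately have "cadlag (\<lambda>x. - f (- x))"
    using R.primitive_on_cell_cadlag[of "\<lambda>x. - f (- x)" "-1" "\<lambda>x. F (- x)"] assms(1) False
    by (simp add: primitive_False[OF m])
  from cadlag_neg[OF this] have "cadlag (\<lambda>x. f (- x))" by simp
  then show ?thesis using assms False by (simp add: cadlag_uminus regulated_def primitive_def)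
qed

lemma strong_deriv_if_primitive:
  assumes f: "primitive b F f" and F: "F \<in> regulated b"
  shows "strong_deriv b f F"
proof (cases b)
  case True
  then show ?thesis
    using W.primitive_on_cell_derivative[of f 0 F] W.integrable_caglad[of F] f F
    by (auto simp: primitive_True regulated_True strong_deriv_True)
next
  case False
  have m: "F \<in> borel_measurable (mu False)" using F borel_measurable_mu regulated_borel by blast
  have F': "periodic1 (\<lambda>x. F (- x))" "caglad (\<lambda>x. F (- x))" using F False by (simp_all add: regulated_False)
  have "periodic1 (\<lambda>x. - f (- x))"
    using f False periodic1_uminus[of f] by (simp add: primitive_def periodic1_def)
  then show ?thesis
    using R.primitive_on_cell_derivative[of "\<lambda>x. - f (- x)" "-1" "\<lambda>x. F (- x)"] f False F'
      R.integrable_caglad[OF F'(2,1)]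
    by (simp add: primitive_False[OF m] strong_deriv_False)
qed

lemma primitive_if_strong_deriv:
  assumes f: "f \<in> regulated (\<not> b)" and F: "F \<in> regulated b" and d: "strong_deriv b f F"
  shows "primitive b F f"
proof (cases b)
  case True
  then show ?thesis
    using W.primitive_on_cell_from_left_derivative[of f F 0] assms
    by (simp add: primitive_True regulated_def strong_deriv_True)
next
  case False
  have m: "F \<in> borel_measurable (mu False)" using F borel_measurable_mu regulated_borel by blast
  have F': "periodic1 (\<lambda>x. F (- x))" "caglad (\<lambda>x. F (- x))" using F False by (simp_all add: regulated_False)
  have f': "periodic1 f" "caglad f" using f False by (simp_all add: regulated_def)
  then have "cadlag (\<lambda>x. - f (- x))" using cadlag_neg cadlag_uminus by blast
  then show ?thesis
    using R.primitive_on_cell_from_left_derivative[of "\<lambda>x. - f (- x)" "\<lambda>x. F (- x)" "-1"] d False F' f'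
    by (simp add: primitive_False[OF m] strong_deriv_False)
qed

lemma regulated_zero_if_AE:
  assumes f: "f \<in> regulated b" and ae: "AE x in mu b. f x = 0"
  shows "f x = 0"
proof (cases b)
  case True
  then have b: "b = True" by simp
  show ?thesis
    using f ae unfolding b mu_True regulated_True by (intro W.caglad_eq_zero_if_AE[of f 0]) auto
next
  case False
  have "f \<in> borel_measurable (dV_torus V)" by (intro borel_measurable_dV regulated_borel[OF f])
  then have "{x \<in> space (dV_torus V). f x = 0} \<in> sets (dV_torus V)" by measurable
  moreover have b: "b = False" using False by simp
  ultimately have "AE x in V_cell. f (- x) = 0" using ae AE_dV unfolding b mu_False by simp
  then have "f (- (- x)) = 0"
    using f unfolding b regulated_False by (intro R.caglad_eq_zero_if_AE[of "\<lambda>x. f (- x)" "-1" "- x"]) auto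
  then show ?thesis by simp
qed

lemma AE_zero_if_primitive_const:
  assumes u: "integrable (mu b) u" and p: "primitive b u (\<lambda>_. a)"
  shows "AE x in mu b. u x = 0"
proof (cases b)
  case True
  then have b: "b = True" by simp
  show ?thesis
    using u p unfolding b mu_True primitive_True by (intro W.AE_zero_if_constant_primitive[of 0 u a]) auto
next
  case False
  have m: "u \<in> borel_measurable (dV_torus V)" using u False by (auto simp: mu_def)
  then have s: "{x \<in> space (dV_torus V). u x = 0} \<in> sets (dV_torus V)" by measurable
  have "integrable V_cell (\<lambda>x. u (- x))" using m u False integrable_dV by (simp add: mu_def)
  then have "AE x in V_cell. u (- x) = 0"
    using R.AE_zero_if_constant_primitive[of "-1" "\<lambda>x. u (- x)" "- a"] p False m
    by (simp add: primitive_False mu_def)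
  moreover have b: "b = False" using False by simp
  ultimately show ?thesis using AE_dV[OF s] unfolding b mu_False by simp
qed

text \<open>
  Functions with a regular strong derivative are dense in \<open>L\<^sup>1\<close>: the delayed interpolants are bounded
  and converge pointwise, so they converge in mean by dominated convergence.
\<close>

lemma regulated_approximation_by_primitives:
  assumes x: "x \<in> regulated b" and e: "e > 0"
  shows "\<exists>z\<in>regulated b. \<exists>h\<in>regulated (\<not> b). strong_deriv (\<not> b) z h \<and> (\<integral>t. \<bar>x t - z t\<bar> \<partial>mu b) \<le> e"
proof -
  have "\<exists>z h B. (\<forall>n::nat. z n \<in> regulated b \<and> h n \<in> regulated (\<not> b) \<and> strong_deriv (\<not> b) (z n) (h n) \<and> (\<forall>t. \<bar>z n t\<bar> \<le> B)) \<and>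
      (\<forall>t. (\<lambda>n. z n t) \<longlonglongrightarrow> x t)"
  proof (cases b)
    case True
    then have "caglad x" "periodic1 x" using x by (simp_all add: regulated_True)
    from V.caglad_approximation[OF this] obtain z h B where
      "\<And>n::nat. caglad (z n)" "\<And>n. periodic1 (z n)" "\<And>n. cadlag (h n)" "\<And>n. periodic1 (h n)"
      "\<And>n t. (diff_quot V (z n) t \<longlongrightarrow> h n t) (at_right 0)"
      "\<And>n t. \<bar>z n t\<bar> \<le> B" "\<And>t. (\<lambda>n. z n t) \<longlonglongrightarrow> x t" by blast
    then show ?thesis
      using True by (intro exI[of _ z] exI[of _ h] exI[of _ B]) (simp add: regulated_def strong_deriv_def)
  next
    case False
    interpret S: left_integrator "\<lambda>x. - W (- x)"
      by (rule left_integrator_reflection) unfold_locales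
    have "caglad (\<lambda>t. x (- t))" "periodic1 (\<lambda>t. x (- t))" using x False by (simp_all add: regulated_False)
    from S.caglad_approximation[OF this] obtain z h B where zh:
      "\<And>n::nat. caglad (z n)" "\<And>n. periodic1 (z n)" "\<And>n. cadlag (h n)" "\<And>n. periodic1 (h n)"
      "\<And>n t. (diff_quot (\<lambda>x. - W (- x)) (z n) t \<longlongrightarrow> h n t) (at_right 0)"
      "\<And>n t. \<bar>z n t\<bar> \<le> B" "\<And>t. (\<lambda>n. z n t) \<longlonglongrightarrow> x (- t)" by blast
    have dq: "diff_quot W (\<lambda>t. z n (- t)) t = (\<lambda>s. - diff_quot (\<lambda>x. - W (- x)) (z n) (- t) (- s))" for n t
    proof
      fix s
      have "diff_quot (\<lambda>x. - W (- x)) (z n) (- t) (- s) = (z n (- (t + s)) - z n (- t)) / (- (W (t + s) - W t))"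
        by (simp add: diff_quot_def add.commute)
      moreover have "- (p / (- q)) = p / q" for p q :: real by simp
      ultimately show "diff_quot W (\<lambda>t. z n (- t)) t s = - diff_quot (\<lambda>x. - W (- x)) (z n) (- t) (- s)"
        by (simp only: diff_quot_def)
    qed
    have "strong_deriv True (\<lambda>t. z n (- t)) (\<lambda>t. - h n (- t))" for n
      unfolding strong_deriv_True dq
      by (auto simp: filterlim_at_left_to_right[where a = 0] intro!: tendsto_minus zh(5))
    moreover have "(\<lambda>t. z n (- t)) \<in> regulated False" for n using zh by (simp add: regulated_False)
    moreover have "(\<lambda>t. - h n (- t)) \<in> regulated True" for n
    proof -
      have "caglad (\<lambda>t. h n (- t))" using zh by (simp add: caglad_uminus)
      from caglad_neg[OF this] show ?thesis
        using zh(4)[of n] periodic1_uminus[of "h n"] by (simp add: regulated_True periodic1_def)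
    qed
    moreover have "(\<lambda>n. z n (- t)) \<longlonglongrightarrow> x t" for t using zh(7)[of "- t"] by simp
    ultimately show ?thesis
      using False zh(6)
      by (intro exI[of _ "\<lambda>n t. z n (- t)"] exI[of _ "\<lambda>n t. - h n (- t)"] exI[of _ B]) simp
  qed
  then obtain z h B where zh: "\<And>n::nat. z n \<in> regulated b" "\<And>n. h n \<in> regulated (\<not> b)" "\<And>n. strong_deriv (\<not> b) (z n) (h n)"
    "\<And>n t. \<bar>z n t\<bar> \<le> B" "\<And>t. (\<lambda>n. z n t) \<longlonglongrightarrow> x t" by blast
  from regulated_bounded[OF x] obtain C where C: "C > 0" "\<And>t. \<bar>x t\<bar> \<le> C" by blast
  have "(\<lambda>n. \<integral>t. \<bar>x t - z n t\<bar> \<partial>mu b) \<longlonglongrightarrow> (\<integral>t. 0 \<partial>mu b)"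
  proof (rule integral_dominated_convergence[where w = "\<lambda>_. C + B"])
    show "AE t in mu b. (\<lambda>n. \<bar>x t - z n t\<bar>) \<longlonglongrightarrow> 0"
    proof (rule AE_I2)
      fix t
      have "(\<lambda>n. \<bar>x t - z n t\<bar>) \<longlonglongrightarrow> \<bar>x t - x t\<bar>" by (intro tendsto_intros zh)
      then show "(\<lambda>n. \<bar>x t - z n t\<bar>) \<longlonglongrightarrow> 0" by simp
    qed
    show "AE t in mu b. norm \<bar>x t - z n t\<bar> \<le> C + B" for n
    proof (rule AE_I2)
      fix t show "norm \<bar>x t - z n t\<bar> \<le> C + B" using C(2)[of t] zh(4)[of n t] by simp
    qed
    show "(\<lambda>t. \<bar>x t - z n t\<bar>) \<in> borel_measurable (mu b)" for n
      using regulated_borel[OF regulated_diff[OF x zh(1)[of n]]] by (intro borel_measurable_mu) simp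
  qed auto
  then have "(\<lambda>n. \<integral>t. \<bar>x t - z n t\<bar> \<partial>mu b) \<longlonglongrightarrow> 0" by simp
  from order_tendstoD(2)[OF this e] obtain n where "(\<integral>t. \<bar>x t - z n t\<bar> \<partial>mu b) < e"
    by (auto simp: eventually_sequentially)
  with zh(1-3)[of n] show ?thesis by (meson less_imp_le)
qed


section \<open>Primitives with mean zero and integration by parts\<close>

lemma primitive_at:
  assumes "primitive b F f" "0 \<le> t" "t \<le> 1"
  shows "f t = f 0 + (\<integral>s. (if (if b then s \<le> t else s < t) then F s else 0) \<partial>mu b)"
proof -
  have "f t - f 0 = (if b then LINT x:{0<..t}|mu b. F x else LINT x:{0..<t}|mu b. F x)"
    using assms by (simp add: primitive_def)
  also have "\<dots> = (\<integral>s. (if (if b then s \<le> t else s < t) then F s else 0) \<partial>mu b)"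
    unfolding set_lebesgue_integral_def
    by (cases b) (auto simp: space_mu indicator_def intro!: Bochner_Integration.integral_cong)
  finally show ?thesis by simp
qed

lemma primitive_integral_zero:
  assumes "primitive b F f"
  shows "(\<integral>x. F x \<partial>mu b) = 0"
proof -
  have "f 1 = f 0 + (\<integral>s. (if (if b then s \<le> 1 else s < 1) then F s else 0) \<partial>mu b)"
    by (rule primitive_at[OF assms]) auto
  also have "(\<integral>s. (if (if b then s \<le> 1 else s < 1) then F s else 0) \<partial>mu b) = (\<integral>x. F x \<partial>mu b)"
    by (rule Bochner_Integration.integral_cong) (auto simp: space_mu)
  finally have "f 1 = f 0 + (\<integral>x. F x \<partial>mu b)" .
  moreover have "f (0 + 1) = f 0" using assms unfolding primitive_def periodic1_def by blast
  ultimately show ?thesis by simp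
qed

lemma primitive_diff:
  assumes "primitive b F f" "primitive b G g" "integrable (mu b) F" "integrable (mu b) G"
  shows "primitive b (\<lambda>x. F x - G x) (\<lambda>x. f x - g x)"
proof -
  have "(LINT x:A|mu b. F x - G x) = (LINT x:A|mu b. F x) - (LINT x:A|mu b. G x)" if "A \<in> sets borel" for A
    using integrable_indicator_mu[OF assms(3) that] integrable_indicator_mu[OF assms(4) that]
    by (simp add: set_lebesgue_integral_def right_diff_distrib)
  note L = this
  show ?thesis
    unfolding primitive_def
  proof (intro conjI allI impI)
    show "periodic1 (\<lambda>x. f x - g x)" using assms(1,2) by (simp add: primitive_def periodic1_def)
    fix s t :: real assume st: "0 \<le> s" "s \<le> t" "t \<le> 1"
    have "f t - g t - (f s - g s) = (f t - f s) - (g t - g s)" by simp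
    also have "f t - f s = (if b then LINT x:{s<..t}|mu b. F x else LINT x:{s..<t}|mu b. F x)"
      using assms(1) st by (simp add: primitive_def)
    also have "g t - g s = (if b then LINT x:{s<..t}|mu b. G x else LINT x:{s..<t}|mu b. G x)"
      using assms(2) st by (simp add: primitive_def)
    finally show "f t - g t - (f s - g s) =
        (if b then LINT x:{s<..t}|mu b. F x - G x else LINT x:{s..<t}|mu b. F x - G x)"
      unfolding L[of "{s<..t}", simplified] L[of "{s..<t}", simplified] by simp
  qed
qed

lemma primitive_diff_const: "primitive b F f \<Longrightarrow> primitive b F (\<lambda>x. f x - a)"
  by (simp add: primitive_def periodic1_def)

lemma primitive_zero: "primitive b (\<lambda>_. 0) (\<lambda>_. a)"
  by (simp add: primitive_def periodic1_def set_lebesgue_integral_def)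

lemma primitive_cong_AE:
  assumes "AE x in mu b. F x = G x" "F \<in> borel_measurable (mu b)" "G \<in> borel_measurable (mu b)" "primitive b F f"
  shows "primitive b G f"
proof -
  have "(LINT x:A|mu b. F x) = (LINT x:A|mu b. G x)" if "A \<in> sets borel" for A
  proof -
    have i: "(indicator A :: real \<Rightarrow> real) \<in> borel_measurable (mu b)" using that by (intro borel_measurable_mu) simp
    show ?thesis
      unfolding set_lebesgue_integral_def
      by (rule integral_cong_AE) (use assms i in \<open>auto intro!: borel_measurable_scaleR\<close>)
  qed
  then have eq: "(LINT x:{s<..t}|mu b. F x) = (LINT x:{s<..t}|mu b. G x)"
    "(LINT x:{s..<t}|mu b. F x) = (LINT x:{s..<t}|mu b. G x)" for s t by simp_all
  from assms(4) show ?thesis unfolding primitive_def eq .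
qed

lemma periodic_unit_representative:
  assumes "periodic1 f"
  obtains t' where "0 \<le> t'" "t' \<le> 1" "f t = f t'"
proof -
  have "f t = f (t - of_int \<lfloor>t\<rfloor>)" using periodic1_shift[OF assms, of t "- \<lfloor>t\<rfloor>"] by simp
  moreover have "0 \<le> t - of_int \<lfloor>t\<rfloor>" "t - of_int \<lfloor>t\<rfloor> \<le> 1" by linarith+
  ultimately show ?thesis using that by blast
qed

lemma primitive_oscillation:
  assumes f: "primitive b F f" and F: "integrable (mu b) F"
  shows "\<bar>f t - f 0\<bar> \<le> (\<integral>x. \<bar>F x\<bar> \<partial>mu b)"
proof -
  have "periodic1 f" using f by (simp add: primitive_def)
  from periodic_unit_representative[OF this] obtain t' where t': "0 \<le> t'" "t' \<le> 1" "f t = f t'" by blast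
  have "f t - f 0 = (\<integral>s. (if (if b then s \<le> t' else s < t') then F s else 0) \<partial>mu b)"
    using primitive_at[OF f t'(1,2)] t'(3) by simp
  also have "\<bar>\<dots>\<bar> \<le> (\<integral>x. \<bar>F x\<bar> \<partial>mu b)"
  proof (rule integral_abs_bound_integral)
    have "(\<lambda>s. if (if b then s \<le> t' else s < t') then F s else 0) =
        (\<lambda>s. indicator (if b then {..t'} else {..<t'}) s * F s)"
      by (auto simp: indicator_def)
    then show "integrable (mu b) (\<lambda>s. if (if b then s \<le> t' else s < t') then F s else 0)"
      using integrable_indicator_mu[OF F, of "if b then {..t'} else {..<t'}"] by simp
  qed (use F in auto)
  finally show ?thesis .
qed

definition total_mass :: "bool \<Rightarrow> real" where
  "total_mass b = measure (mu b) (space (mu b))"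

lemma total_mass_pos: "total_mass b > 0"
  using mu_space_pos by (simp add: total_mass_def)

definition mean_zero :: "bool \<Rightarrow> (real \<Rightarrow> real) set" where
  "mean_zero b = {f \<in> regulated b. (\<integral>x. f x \<partial>mu b) = 0}"

lemma mean_zero_regulated: "f \<in> mean_zero b \<Longrightarrow> f \<in> regulated b"
  by (simp add: mean_zero_def)

lemma mean_zero_integrable: "f \<in> mean_zero b \<Longrightarrow> integrable (mu b) f"
  by (auto simp: mean_zero_def intro: regulated_integrable)

lemma mean_zero_integral: "f \<in> mean_zero b \<Longrightarrow> (\<integral>x. f x \<partial>mu b) = 0"
  by (simp add: mean_zero_def)

lemma mean_zero_diff: "f \<in> mean_zero b \<Longrightarrow> g \<in> mean_zero b \<Longrightarrow> (\<lambda>x. f x - g x) \<in> mean_zero b"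
  by (auto simp: mean_zero_def regulated_diff regulated_integrable)

lemma diff_mean_in_mean_zero:
  assumes "f \<in> regulated b"
  shows "(\<lambda>x. f x - (\<integral>x. f x \<partial>mu b) / total_mass b) \<in> mean_zero b"
  using assms total_mass_pos[of b] regulated_integrable[OF assms, of b]
  by (simp add: mean_zero_def regulated_diff regulated_const total_mass_def)

lemma antiderivative_exists:
  assumes "integrable (mu b) F" "(\<integral>x. F x \<partial>mu b) = 0"
  shows "\<exists>f. f \<in> mean_zero (\<not> b) \<and> primitive b F f"
proof -
  from primitive_exists[OF assms] obtain f where f: "primitive b F f" ..
  from diff_mean_in_mean_zero[OF primitive_regulated[OF this assms(1)]] primitive_diff_const[OF f]
  show ?thesis by blast
qed

text \<open>
  The oscillation of \<open>f\<close> is at most the \<open>L\<^sup>1\<close> norm of \<open>F\<close>, and mean zero bounds \<open>f 0\<close> by the oscillation.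
  Integration thus maps \<open>L\<^sup>1\<close> continuously into the bounded functions.
\<close>

lemma antiderivative_bound:
  assumes f: "f \<in> mean_zero (\<not> b)" "primitive b F f" and F: "integrable (mu b) F"
  shows "\<bar>f t\<bar> \<le> 2 * (\<integral>x. \<bar>F x\<bar> \<partial>mu b)"
proof -
  let ?A = "\<integral>x. \<bar>F x\<bar> \<partial>mu b"
  have osc: "\<bar>f t - f 0\<bar> \<le> ?A" for t by (rule primitive_oscillation[OF f(2) F])
  have i: "integrable (mu (\<not> b)) f" by (rule mean_zero_integrable[OF f(1)])
  have "(\<integral>x. f x - f 0 \<partial>mu (\<not> b)) = - (f 0 * total_mass (\<not> b))"
    using i mean_zero_integral[OF f(1)] by (simp add: total_mass_def)
  moreover have "\<bar>\<integral>x. f x - f 0 \<partial>mu (\<not> b)\<bar> \<le> (\<integral>x. ?A \<partial>mu (\<not> b))"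
    by (rule integral_abs_bound_integral) (use i osc in auto)
  ultimately have "\<bar>f 0\<bar> * total_mass (\<not> b) \<le> ?A * total_mass (\<not> b)"
    using total_mass_pos[of "\<not> b"] by (simp add: abs_mult total_mass_def mult.commute)
  then have "\<bar>f 0\<bar> \<le> ?A" using total_mass_pos[of "\<not> b"] by simp
  with osc[of t] show ?thesis by linarith
qed

text \<open>
  Apply Fubini to \<open>F s * G t\<close> on the two triangles \<open>s \<le> t\<close> and \<open>t < s\<close>. Integrating first over \<open>s\<close>
  produces \<open>f t - f 0\<close> on the former, integrating first over \<open>t\<close> produces \<open>g s - g 0\<close> on the latter, and
  the integral over the whole square is the product of the two vanishing means. The half-open
  intervals of the two sides are complementary, so a common jump of \<open>W\<close> and \<open>V\<close> is counted once.
\<close>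

lemma integration_by_parts_core:
  assumes f: "primitive True F f" "integrable (mu True) F" and g: "primitive False G g" "integrable (mu False) G"
  shows "(\<integral>t. f t * G t \<partial>mu False) + (\<integral>s. F s * g s \<partial>mu True) = 0"
proof -
  let ?M = "mu True" and ?N = "mu False"
  interpret P: pair_sigma_finite ?M ?N ..
  have [measurable]: "F \<in> borel_measurable ?M" "G \<in> borel_measurable ?N" using f g by auto
  have id [measurable]: "(\<lambda>x. x) \<in> borel_measurable (mu b)" for b by (intro borel_measurable_mu) simp
  have [measurable]: "fst \<in> borel_measurable (?M \<Otimes>\<^sub>M ?N)" "snd \<in> borel_measurable (?M \<Otimes>\<^sub>M ?N)"
    using measurable_compose[OF measurable_fst id] measurable_compose[OF measurable_snd id] by simp_all
  have prod: "integrable (?M \<Otimes>\<^sub>M ?N) (\<lambda>p. F (fst p) * G (snd p))"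
  proof (rule P.Fubini_integrable)
    show "(\<lambda>p. F (fst p) * G (snd p)) \<in> borel_measurable (?M \<Otimes>\<^sub>M ?N)" by measurable
    show "integrable ?M (\<lambda>x. \<integral>y. norm (F (fst (x, y)) * G (snd (x, y))) \<partial>?N)"
      using f(2) by (simp add: abs_mult)
    show "AE x in ?M. integrable ?N (\<lambda>y. F (fst (x, y)) * G (snd (x, y)))"
      using g(2) by simp
  qed
  define k where "k s t = (if s \<le> t then F s * G t else 0)" for s t
  define l where "l s t = (if t < s then F s * G t else 0)" for s t
  have [measurable]: "case_prod k \<in> borel_measurable (?M \<Otimes>\<^sub>M ?N)" "case_prod l \<in> borel_measurable (?M \<Otimes>\<^sub>M ?N)"
    unfolding k_def l_def case_prod_beta by measurable
  have k: "integrable (?M \<Otimes>\<^sub>M ?N) (case_prod k)"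
    by (rule Bochner_Integration.integrable_bound[OF prod]) (auto simp: k_def case_prod_beta)
  have l: "integrable (?M \<Otimes>\<^sub>M ?N) (case_prod l)"
    by (rule Bochner_Integration.integrable_bound[OF prod]) (auto simp: l_def case_prod_beta)
  have f_eq: "f t * G t = f 0 * G t + (\<integral>s. k s t \<partial>?M)" if "t \<in> space ?N" for t
  proof -
    have "f t * G t = f 0 * G t + (\<integral>s. (if s \<le> t then F s else 0) \<partial>?M) * G t"
      using primitive_at[OF f(1), of t] that by (simp add: space_mu distrib_right)
    also have "(\<integral>s. (if s \<le> t then F s else 0) \<partial>?M) * G t = (\<integral>s. (if s \<le> t then F s else 0) * G t \<partial>?M)"
      by simp
    also have "\<dots> = (\<integral>s. k s t \<partial>?M)"
      by (rule Bochner_Integration.integral_cong) (auto simp: k_def)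
    finally show ?thesis .
  qed
  have g_eq: "F s * g s = g 0 * F s + (\<integral>t. l s t \<partial>?N)" if "s \<in> space ?M" for s
  proof -
    have "F s * g s = g 0 * F s + F s * (\<integral>t. (if t < s then G t else 0) \<partial>?N)"
      using primitive_at[OF g(1), of s] that by (simp add: space_mu distrib_left)
    also have "F s * (\<integral>t. (if t < s then G t else 0) \<partial>?N) = (\<integral>t. F s * (if t < s then G t else 0) \<partial>?N)"
      by simp
    also have "\<dots> = (\<integral>t. l s t \<partial>?N)"
      by (rule Bochner_Integration.integral_cong) (auto simp: l_def)
    finally show ?thesis .
  qed
  have "(\<integral>t. f t * G t \<partial>?N) = (\<integral>t. f 0 * G t + (\<integral>s. k s t \<partial>?M) \<partial>?N)"
    by (rule Bochner_Integration.integral_cong) (auto simp: f_eq)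
  also have "\<dots> = (\<integral>t. (\<integral>s. k s t \<partial>?M) \<partial>?N)"
    using g(2) P.integrable_snd[OF k] primitive_integral_zero[OF g(1)] by simp
  also have "\<dots> = integral\<^sup>L (?M \<Otimes>\<^sub>M ?N) (case_prod k)" by (rule P.integral_snd[OF k])
  finally have 1: "(\<integral>t. f t * G t \<partial>?N) = integral\<^sup>L (?M \<Otimes>\<^sub>M ?N) (case_prod k)" .
  have "(\<integral>s. F s * g s \<partial>?M) = (\<integral>s. g 0 * F s + (\<integral>t. l s t \<partial>?N) \<partial>?M)"
    by (rule Bochner_Integration.integral_cong) (auto simp: g_eq)
  also have "\<dots> = (\<integral>s. (\<integral>t. l s t \<partial>?N) \<partial>?M)"
    using f(2) P.integrable_fst[OF l] primitive_integral_zero[OF f(1)] by simp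
  also have "\<dots> = integral\<^sup>L (?M \<Otimes>\<^sub>M ?N) (case_prod l)" by (rule P.integral_fst[OF l])
  finally have 2: "(\<integral>s. F s * g s \<partial>?M) = integral\<^sup>L (?M \<Otimes>\<^sub>M ?N) (case_prod l)" .
  have "integral\<^sup>L (?M \<Otimes>\<^sub>M ?N) (case_prod k) + integral\<^sup>L (?M \<Otimes>\<^sub>M ?N) (case_prod l)
      = (\<integral>p. case_prod k p + case_prod l p \<partial>(?M \<Otimes>\<^sub>M ?N))"
    using k l by simp
  also have "\<dots> = (\<integral>p. F (fst p) * G (snd p) \<partial>(?M \<Otimes>\<^sub>M ?N))"
    by (rule Bochner_Integration.integral_cong) (auto simp: k_def l_def)
  also have "\<dots> = (\<integral>s. (\<integral>t. F s * G t \<partial>?N) \<partial>?M)"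
    using P.integral_fst'[OF prod] by simp
  also have "\<dots> = 0" using primitive_integral_zero[OF g(1)] by simp
  finally show ?thesis using 1 2 by simp
qed

lemma integration_by_parts:
  assumes f: "primitive b F f" "integrable (mu b) F" and g: "primitive (\<not> b) G g" "integrable (mu (\<not> b)) G"
  shows "(\<integral>t. f t * G t \<partial>mu (\<not> b)) = - (\<integral>s. F s * g s \<partial>mu b)"
proof (cases b)
  case True
  then have b: "b = True" by simp
  show ?thesis
    using integration_by_parts_core[of F f G g] f g unfolding b by simp
next
  case False
  then have b: "b = False" by simp
  show ?thesis
    using integration_by_parts_core[of G g F f] f g unfolding b by (simp add: mult.commute)
qed

section \<open>Density of the smooth functions\<close>

text \<open>
  By \<open>primitive_unique\<close> below, the choice is forced when \<open>F\<close> is regular with mean zero.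
\<close>

definition antiderivative :: "bool \<Rightarrow> (real \<Rightarrow> real) \<Rightarrow> real \<Rightarrow> real" where
  "antiderivative b F = (SOME f. f \<in> mean_zero (\<not> b) \<and> primitive b F f)"

lemma
  assumes "F \<in> mean_zero b"
  shows antiderivative_mean_zero: "antiderivative b F \<in> mean_zero (\<not> b)"
    and primitive_antiderivative: "primitive b F (antiderivative b F)"
  using someI_ex[OF antiderivative_exists[OF mean_zero_integrable[OF assms] mean_zero_integral[OF assms]]]
  unfolding antiderivative_def by blast+

lemma antiderivative_dist_L1:
  assumes F: "F \<in> mean_zero b" and G: "G \<in> mean_zero b"
  shows "\<bar>antiderivative b F t - antiderivative b G t\<bar> \<le> 2 * (\<integral>x. \<bar>F x - G x\<bar> \<partial>mu b)"
proof (rule antiderivative_bound[where f = "\<lambda>t. antiderivative b F t - antiderivative b G t"])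
  show "(\<lambda>t. antiderivative b F t - antiderivative b G t) \<in> mean_zero (\<not> b)"
    using F G by (intro mean_zero_diff antiderivative_mean_zero)
  show "primitive b (\<lambda>x. F x - G x) (\<lambda>t. antiderivative b F t - antiderivative b G t)"
    using F G by (intro primitive_diff primitive_antiderivative mean_zero_integrable)
  show "integrable (mu b) (\<lambda>x. F x - G x)"
    using F G by (intro mean_zero_integrable mean_zero_diff)
qed

text \<open>
  A Lipschitz constant of both antiderivative operators in the supremum norm, made at least 1
  so that its powers do not fall below 1.
\<close>

definition stretch :: real where
  "stretch = 1 + 2 * (total_mass True + total_mass False)"

lemma stretch_ge_1: "stretch \<ge> 1"
  using total_mass_pos[of True] total_mass_pos[of False] by (simp add: stretch_def)

lemma antiderivative_dist_sup:
  assumes F: "F \<in> mean_zero b" and G: "G \<in> mean_zero b" and d: "\<And>x. \<bar>F x - G x\<bar> \<le> d"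
  shows "\<bar>antiderivative b F t - antiderivative b G t\<bar> \<le> stretch * d"
proof -
  have d0: "d \<ge> 0" using d[of 0] by linarith
  have "(\<integral>x. \<bar>F x - G x\<bar> \<partial>mu b) \<le> (\<integral>x. d \<partial>mu b)"
    using mean_zero_integrable[OF mean_zero_diff[OF F G]] d by (intro integral_mono) auto
  also have "\<dots> = total_mass b * d" by (simp add: total_mass_def)
  finally have "2 * (\<integral>x. \<bar>F x - G x\<bar> \<partial>mu b) \<le> 2 * total_mass b * d" by simp
  also have "\<dots> \<le> stretch * d"
    using total_mass_pos[of True] total_mass_pos[of False] d0 by (intro mult_right_mono) (cases b; simp add: stretch_def)+
  finally show ?thesis using antiderivative_dist_L1[OF F G, of t] by linarith
qed

lemma primitive_unique:
  assumes "primitive b F f" "primitive b F g" "integrable (mu b) F" "f \<in> mean_zero (\<not> b)" "g \<in> mean_zero (\<not> b)"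
  shows "f t = g t"
proof -
  have "\<bar>f t - g t\<bar> \<le> 2 * (\<integral>x. \<bar>F x - F x\<bar> \<partial>mu b)"
    using assms by (intro antiderivative_bound[where f = "\<lambda>t. f t - g t"] mean_zero_diff primitive_diff) auto
  then show ?thesis by simp
qed


definition side :: "bool \<Rightarrow> nat \<Rightarrow> bool" where
  "side b n = (if even n then b else \<not> b)"

lemma side_0 [simp]: "side b 0 = b"
  by (simp add: side_def)

lemma side_Suc: "side b (Suc n) = (\<not> side b n)"
  by (simp add: side_def)

lemma side_Not: "side (\<not> b) n = (\<not> side b n)"
  by (simp add: side_def)

text \<open>
  A smooth function with mean zero is the head of an infinite sequence in which every member is a
  primitive of the next. In terms of primitives, smoothness can be obtained by passing to uniform
  limits, which derivatives do not allow.
\<close>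

definition smooth_chain :: "bool \<Rightarrow> (nat \<Rightarrow> real \<Rightarrow> real) \<Rightarrow> bool" where
  "smooth_chain b y \<longleftrightarrow> (\<forall>n. y n \<in> mean_zero (side b n) \<and> primitive (side b (Suc n)) (y (Suc n)) (y n))"

definition smooth :: "bool \<Rightarrow> (real \<Rightarrow> real) \<Rightarrow> bool" where
  "smooth b f \<longleftrightarrow> (\<exists>y. smooth_chain b y \<and> y 0 = f)"

lemma smooth_mean_zero:
  assumes "smooth b f"
  shows "f \<in> mean_zero b"
proof -
  from assms obtain y where y: "smooth_chain b y" "y 0 = f" unfolding smooth_def by blast
  from y(1) have "y 0 \<in> mean_zero (side b 0)" unfolding smooth_chain_def by blast
  with y(2) show ?thesis by simp
qed

lemma smooth_antiderivative:
  assumes "smooth b f"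
  shows "smooth (\<not> b) (antiderivative b f)"
proof -
  from assms obtain y where y: "smooth_chain b y" "y 0 = f" unfolding smooth_def by blast
  have f: "f \<in> mean_zero b" by (rule smooth_mean_zero[OF assms])
  define y' where "y' n = (case n of 0 \<Rightarrow> antiderivative b f | Suc m \<Rightarrow> y m)" for n
  have "smooth_chain (\<not> b) y'"
    unfolding smooth_chain_def
  proof
    fix n
    show "y' n \<in> mean_zero (side (\<not> b) n) \<and> primitive (side (\<not> b) (Suc n)) (y' (Suc n)) (y' n)"
    proof (cases n)
      case 0
      then show ?thesis
        using antiderivative_mean_zero[OF f] primitive_antiderivative[OF f] y(2)
        by (simp add: y'_def side_Suc)
    next
      case (Suc m)
      then show ?thesis
        using y(1) unfolding smooth_chain_def by (simp add: y'_def side_Suc side_Not)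
    qed
  qed
  then show ?thesis unfolding smooth_def by (auto simp: y'_def intro!: exI[of _ y'])
qed

definition antiderivatives :: "bool \<Rightarrow> (real \<Rightarrow> real) set" where
  "antiderivatives b = antiderivative (\<not> b) ` mean_zero (\<not> b)"

lemma antiderivatives_mean_zero: "x \<in> antiderivatives b \<Longrightarrow> x \<in> mean_zero b"
  unfolding antiderivatives_def using antiderivative_mean_zero[of _ "\<not> b"] by auto

text \<open>
  If \<open>x\<close> is the antiderivative of \<open>w\<close>, approximate \<open>w\<close> in \<open>L\<^sup>1\<close> by an antiderivative \<open>x'\<close>. Integrating once more
  turns the \<open>L\<^sup>1\<close> error into a uniform one.
\<close>

lemma antiderivatives_approximation:
  assumes x: "x \<in> antiderivatives b" and e: "e > 0"
  shows "\<exists>x'\<in>antiderivatives (\<not> b). \<forall>t. \<bar>x t - antiderivative (\<not> b) x' t\<bar> \<le> e"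
proof -
  from x obtain w where w: "w \<in> mean_zero (\<not> b)" "x = antiderivative (\<not> b) w"
    unfolding antiderivatives_def by blast
  from regulated_approximation_by_primitives[OF mean_zero_regulated[OF w(1)], of "e/4"] e obtain z h where
    z: "z \<in> regulated (\<not> b)" and h: "h \<in> regulated b" and zh: "strong_deriv b z h"
    and close: "(\<integral>t. \<bar>w t - z t\<bar> \<partial>mu (\<not> b)) \<le> e/4"
    by auto
  have primitive: "primitive b h z" by (rule primitive_if_strong_deriv[OF z h zh])
  have h0: "h \<in> mean_zero b" using h primitive_integral_zero[OF primitive] by (simp add: mean_zero_def)
  define m where "m = (\<integral>t. z t \<partial>mu (\<not> b))"
  define x' where "x' = antiderivative b h"
  have x'_eq: "x' t = z t - m / total_mass (\<not> b)" for t
    unfolding x'_def m_def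
    using primitive_unique[OF primitive_antiderivative[OF h0] primitive_diff_const[OF primitive] mean_zero_integrable[OF h0]
        antiderivative_mean_zero[OF h0] diff_mean_in_mean_zero[OF z]] .
  have x': "x' \<in> antiderivatives (\<not> b)" unfolding antiderivatives_def x'_def using h0 by simp
  have iw: "integrable (mu (\<not> b)) w" and iz: "integrable (mu (\<not> b)) z"
    using w z by (auto intro: mean_zero_integrable regulated_integrable)
  have "\<bar>m\<bar> = \<bar>\<integral>t. w t - z t \<partial>mu (\<not> b)\<bar>"
    using iw iz mean_zero_integral[OF w(1)] by (simp add: m_def)
  also have "\<dots> \<le> (\<integral>t. \<bar>w t - z t\<bar> \<partial>mu (\<not> b))" by (rule integral_abs_bound)
  finally have m: "\<bar>m\<bar> \<le> e/4" using close by simp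
  have "(\<integral>t. \<bar>w t - x' t\<bar> \<partial>mu (\<not> b)) \<le> (\<integral>t. \<bar>w t - z t\<bar> + \<bar>m\<bar> / total_mass (\<not> b) \<partial>mu (\<not> b))"
  proof (rule integral_mono)
    show "integrable (mu (\<not> b)) (\<lambda>t. \<bar>w t - x' t\<bar>)" unfolding x'_eq using iw iz by auto
    show "integrable (mu (\<not> b)) (\<lambda>t. \<bar>w t - z t\<bar> + \<bar>m\<bar> / total_mass (\<not> b))" using iw iz by auto
    show "\<bar>w t - x' t\<bar> \<le> \<bar>w t - z t\<bar> + \<bar>m\<bar> / total_mass (\<not> b)" for t
    proof -
      have "\<bar>m / total_mass (\<not> b)\<bar> = \<bar>m\<bar> / total_mass (\<not> b)" using total_mass_pos[of "\<not> b"] by (simp add: abs_divide)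
      then show ?thesis unfolding x'_eq by linarith
    qed
  qed
  also have "\<dots> = (\<integral>t. \<bar>w t - z t\<bar> \<partial>mu (\<not> b)) + \<bar>m\<bar>"
    using iw iz total_mass_pos[of "\<not> b"] by (simp add: total_mass_def)
  also have "\<dots> \<le> e/2" using close m by simp
  finally have d: "(\<integral>t. \<bar>w t - x' t\<bar> \<partial>mu (\<not> b)) \<le> e/2" .
  have "\<bar>x t - antiderivative (\<not> b) x' t\<bar> \<le> e" for t
    using antiderivative_dist_L1[OF w(1) antiderivatives_mean_zero[OF x'], of t] d w(2) by simp
  with x' show ?thesis by blast
qed

lemma integral_uniform_limit:
  assumes f: "\<And>n::nat. f n \<in> regulated b" and g: "g \<in> regulated b" and lim: "uniform_limit UNIV f g sequentially"
    and A: "A \<in> sets borel"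
  shows "(\<lambda>n. \<integral>x. indicator A x * f n x \<partial>mu c) \<longlonglongrightarrow> (\<integral>x. indicator A x * g x \<partial>mu c)"
proof (rule tendstoI)
  fix e :: real assume e: "e > 0"
  have i: "integrable (mu c) (\<lambda>x. indicator A x * f n x)" "integrable (mu c) (\<lambda>x. indicator A x * g x)" for n
    using integrable_indicator_mu[OF regulated_integrable[OF f] A] integrable_indicator_mu[OF regulated_integrable[OF g] A]
    by auto
  define d where "d = e / (2 * total_mass c)"
  have d: "d > 0" using e total_mass_pos[of c] by (simp add: d_def)
  from uniform_limitD[OF lim d] show "\<forall>\<^sub>F n in sequentially.
      dist (\<integral>x. indicator A x * f n x \<partial>mu c) (\<integral>x. indicator A x * g x \<partial>mu c) < e"
  proof eventually_elim
    case (elim n)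
    have "\<bar>\<integral>x. indicator A x * f n x - indicator A x * g x \<partial>mu c\<bar> \<le> (\<integral>x. d \<partial>mu c)"
    proof (rule integral_abs_bound_integral)
      fix x
      have "\<bar>f n x - g x\<bar> \<le> d" using elim by (simp add: dist_real_def less_imp_le)
      then show "\<bar>indicator A x * f n x - indicator A x * g x\<bar> \<le> d"
        using d by (auto simp: indicator_def)
    qed (use i in auto)
    also have "\<dots> = e / 2" using total_mass_pos[of c] by (simp add: d_def total_mass_def[symmetric] mult.commute)
    finally show ?case using i e by (simp add: dist_real_def)
  qed
qed

lemma primitive_uniform_limit:
  assumes F: "\<And>n::nat. F n \<in> regulated b" "uniform_limit UNIV F G sequentially"
    and f: "\<And>n. primitive b (F n) (f n)" "\<And>t. (\<lambda>n. f n t) \<longlonglongrightarrow> g t"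
  shows "primitive b G g"
proof -
  have G: "G \<in> regulated b" by (rule regulated_uniform_limit[OF F])
  have lim: "(\<lambda>n. LINT x:A|mu b. F n x) \<longlonglongrightarrow> (LINT x:A|mu b. G x)" if "A \<in> sets borel" for A
    using integral_uniform_limit[OF F(1) G F(2) that, of b] by (simp add: set_lebesgue_integral_def)
  show ?thesis
    unfolding primitive_def
  proof (intro conjI allI impI)
    show "periodic1 g"
      unfolding periodic1_def
    proof
      fix x
      have "f n (x + 1) = f n x" for n using f(1)[of n] by (simp add: primitive_def periodic1_def)
      then show "g (x + 1) = g x" using f(2)[of "x + 1"] f(2)[of x] LIMSEQ_unique by simp
    qed
    fix s t :: real assume st: "0 \<le> s" "s \<le> t" "t \<le> 1"
    have "f n t - f n s = (if b then LINT x:{s<..t}|mu b. F n x else LINT x:{s..<t}|mu b. F n x)" for n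
      using f(1)[of n] st unfolding primitive_def by blast
    moreover have "(\<lambda>n. f n t - f n s) \<longlonglongrightarrow> g t - g s" by (intro tendsto_intros f)
    ultimately have "(\<lambda>n. if b then LINT x:{s<..t}|mu b. F n x else LINT x:{s..<t}|mu b. F n x) \<longlonglongrightarrow> g t - g s"
      by simp
    moreover have "(\<lambda>n. if b then LINT x:{s<..t}|mu b. F n x else LINT x:{s..<t}|mu b. F n x) \<longlonglongrightarrow>
        (if b then LINT x:{s<..t}|mu b. G x else LINT x:{s..<t}|mu b. G x)"
      using lim[of "{s<..t}"] lim[of "{s..<t}"] by (cases b) auto
    ultimately show "g t - g s = (if b then LINT x:{s<..t}|mu b. G x else LINT x:{s..<t}|mu b. G x)"
      by (rule LIMSEQ_unique)
  qed
qed

lemma mean_zero_uniform_limit: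
  assumes "\<And>n::nat. f n \<in> mean_zero b" "uniform_limit UNIV f g sequentially"
  shows "g \<in> mean_zero b"
proof -
  have f: "f n \<in> regulated b" for n by (rule mean_zero_regulated[OF assms(1)])
  have g: "g \<in> regulated b" by (rule regulated_uniform_limit[OF f assms(2)])
  have "(\<lambda>n. \<integral>x. f n x \<partial>mu b) \<longlonglongrightarrow> (\<integral>x. g x \<partial>mu b)"
    using integral_uniform_limit[OF f g assms(2), of UNIV b] by simp
  then have "(\<lambda>n::nat. 0) \<longlonglongrightarrow> (\<integral>x. g x \<partial>mu b)"
    by (simp only: mean_zero_integral[OF assms(1)])
  then have "(\<integral>x. g x \<partial>mu b) = 0" by (simp add: LIMSEQ_const_iff)
  with g show ?thesis by (simp add: mean_zero_def)
qed

text \<open>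
  A Mittag-Leffler argument. Approximate \<open>x\<close> by an antiderivative of \<open>xs 1\<close>, then \<open>xs 1\<close> by an
  antiderivative of \<open>xs 2\<close>, and so on, with errors that decrease fast enough to survive all the
  integrations that follow. For each \<open>n\<close>, the \<open>j\<close>-fold antiderivatives \<open>a j n\<close> of \<open>xs (n + j)\<close> converge uniformly as
  \<open>j\<close> grows, and their limits \<open>y n\<close> form a smooth chain because integration is continuous.
\<close>

theorem smooth_approximation:
  assumes x: "x \<in> antiderivatives b" and e: "e > 0"
  shows "\<exists>y. smooth b y \<and> (\<forall>t. \<bar>y t - x t\<bar> \<le> e)"
proof -
  \<comment> \<open>The power of the Lipschitz constant pays for \<open>n\<close> further integrations of the error made at level \<open>n\<close>.\<close>
  define \<delta> where "\<delta> n = e / (2 ^ Suc n * stretch ^ n)" for n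
  have \<delta>: "\<delta> n > 0" for n using e stretch_ge_1 by (simp add: \<delta>_def)
  have "\<exists>xs. \<forall>n. (xs n \<in> antiderivatives (side b n) \<and> (n = 0 \<longrightarrow> xs n = x)) \<and>
      (\<forall>t. \<bar>xs n t - antiderivative (side b (Suc n)) (xs (Suc n)) t\<bar> \<le> \<delta> n)"
  proof (rule dependent_nat_choice)
    show "\<exists>y. y \<in> antiderivatives (side b 0) \<and> (0 = 0 \<longrightarrow> y = x)" using x by auto
    fix y n assume "y \<in> antiderivatives (side b n) \<and> (n = 0 \<longrightarrow> y = x)"
    with antiderivatives_approximation[OF _ \<delta>, of y "side b n" n]
    show "\<exists>z. (z \<in> antiderivatives (side b (Suc n)) \<and> (Suc n = 0 \<longrightarrow> z = x)) \<and>
        (\<forall>t. \<bar>y t - antiderivative (side b (Suc n)) z t\<bar> \<le> \<delta> n)"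
      by (auto simp: side_Suc)
  qed
  then obtain xs where xs: "\<And>n. xs n \<in> antiderivatives (side b n)" "xs 0 = x"
    "\<And>n t. \<bar>xs n t - antiderivative (side b (Suc n)) (xs (Suc n)) t\<bar> \<le> \<delta> n" by blast
  \<comment> \<open>\<open>a j n\<close> integrates \<open>xs (n + j)\<close> back down to level \<open>n\<close>.\<close>
  define a where "a = rec_nat xs (\<lambda>j g n. antiderivative (side b (Suc n)) (g (Suc n)))"
  have a0: "a 0 n = xs n" and aS: "a (Suc j) n = antiderivative (side b (Suc n)) (a j (Suc n))" for j n
    by (simp_all add: a_def)
  have am: "a j n \<in> mean_zero (side b n)" for j n
  proof (induction j arbitrary: n)
    case 0
    show ?case unfolding a0 by (rule antiderivatives_mean_zero[OF xs(1)])
  next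
    case (Suc j)
    from antiderivative_mean_zero[OF Suc[of "Suc n"]] show ?case unfolding aS by (simp add: side_Suc)
  qed
  have step: "\<bar>a (Suc j) n t - a j n t\<bar> \<le> stretch ^ j * \<delta> (n + j)" for j n t
  proof (induction j arbitrary: n t)
    case 0
    show ?case using xs(3)[of n t] by (simp add: aS a0 abs_minus_commute)
  next
    case (Suc j)
    have "\<bar>a (Suc (Suc j)) n t - a (Suc j) n t\<bar> \<le> stretch * (stretch ^ j * \<delta> (Suc n + j))"
      unfolding aS[of "Suc j"] aS[of j n]
      by (rule antiderivative_dist_sup[OF am am Suc])
    then show ?case by simp
  qed
  have geo: "stretch ^ j * \<delta> (n + j) \<le> e * (1/2) ^ Suc j" for j n
  proof -
    have s: "stretch ^ n \<ge> 1" "(2::real) ^ n \<ge> 1" using stretch_ge_1 by (simp_all add: one_le_power)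
    have sj: "stretch \<noteq> 0" using stretch_ge_1 by simp
    have "stretch ^ j * \<delta> (n + j) = e * (1/2) ^ Suc j * (1 / (2 ^ n * stretch ^ n))"
      using sj by (simp add: \<delta>_def power_add power_divide field_simps)
    also have "\<dots> \<le> e * (1/2) ^ Suc j * 1"
    proof (rule mult_left_mono)
      have "1 * 1 \<le> (2::real) ^ n * stretch ^ n" using s by (intro mult_mono) auto
      then show "1 / (2 ^ n * stretch ^ n) \<le> 1" by (simp add: divide_le_eq_1)
    qed (use e in auto)
    finally show ?thesis by simp
  qed
  have step': "\<bar>a (Suc j) n t - a j n t\<bar> \<le> e * (1/2) ^ Suc j" for j n t
    by (rule order_trans[OF step geo])
  define y where "y n t = a 0 n t + (\<Sum>i. a (Suc i) n t - a i n t)" for n t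
  have ul: "uniform_limit UNIV (\<lambda>j t. a j n t) (y n) sequentially" for n
  proof -
    have "summable (\<lambda>j. e * (1/2) ^ Suc j :: real)"
      by (intro summable_mult summable_Suc_iff[THEN iffD2] summable_geometric) simp
    then have "uniform_limit UNIV (\<lambda>j t. \<Sum>i<j. a (Suc i) n t - a i n t) (\<lambda>t. \<Sum>i. a (Suc i) n t - a i n t) sequentially"
      by (intro Weierstrass_m_test[where M = "\<lambda>j. e * (1/2) ^ Suc j"]) (simp_all only: real_norm_def step')
    then have "uniform_limit UNIV (\<lambda>j t. a 0 n t + (\<Sum>i<j. a (Suc i) n t - a i n t)) (y n) sequentially"
      unfolding y_def by (intro uniform_limit_intros)
    moreover have "a 0 n t + (\<Sum>i<j. a (Suc i) n t - a i n t) = a j n t" for j t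
      by (simp add: sum_lessThan_telescope[of "\<lambda>i. a i n t"])
    ultimately show ?thesis by simp
  qed
  have "smooth_chain b y"
    unfolding smooth_chain_def
  proof (intro allI conjI)
    fix n
    show "y n \<in> mean_zero (side b n)" by (rule mean_zero_uniform_limit[OF am ul])
    show "primitive (side b (Suc n)) (y (Suc n)) (y n)"
    proof (rule primitive_uniform_limit[where F = "\<lambda>j. a j (Suc n)" and f = "\<lambda>j. a (Suc j) n"])
      show "a j (Suc n) \<in> regulated (side b (Suc n))" for j by (rule mean_zero_regulated[OF am])
      show "uniform_limit UNIV (\<lambda>j. a j (Suc n)) (y (Suc n)) sequentially" by (rule ul)
      show "primitive (side b (Suc n)) (a j (Suc n)) (a (Suc j) n)" for j
        unfolding aS by (rule primitive_antiderivative[OF am])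
      show "(\<lambda>j. a (Suc j) n t) \<longlonglongrightarrow> y n t" for t
        by (rule LIMSEQ_Suc) (rule tendsto_uniform_limitI[OF ul[of n] UNIV_I])
    qed
  qed
  then have "smooth b (y 0)" unfolding smooth_def by blast
  moreover have "\<bar>y 0 t - x t\<bar> \<le> e" for t
  proof -
    have "\<bar>a j 0 t - x t\<bar> \<le> e * (1 - (1/2) ^ j)" for j
    proof (induction j)
      case 0
      show ?case by (simp add: a0 xs(2))
    next
      case (Suc j)
      define q where "q = e * (1/2) ^ j"
      have "\<bar>a (Suc j) 0 t - a j 0 t\<bar> \<le> q / 2" "\<bar>a j 0 t - x t\<bar> \<le> e - q"
        using step'[of j 0 t] Suc by (simp_all add: q_def right_diff_distrib)
      then have "\<bar>a (Suc j) 0 t - x t\<bar> \<le> e - q / 2" by linarith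
      then show ?case by (simp add: q_def right_diff_distrib)
    qed
    note 1 = this
    have 2: "e * (1 - (1/2) ^ j) \<le> e * 1" for j using e by (intro mult_left_mono) auto
    have bd: "\<bar>a j 0 t - x t\<bar> \<le> e" for j using order_trans[OF 1 2, of j] by simp
    have "(\<lambda>j. a j 0 t) \<longlonglongrightarrow> y 0 t" using tendsto_uniform_limitI[OF ul[of 0], of t] by simp
    then have "(\<lambda>j. \<bar>a j 0 t - x t\<bar>) \<longlonglongrightarrow> \<bar>y 0 t - x t\<bar>" by (intro tendsto_intros)
    then show ?thesis by (rule LIMSEQ_le_const2) (use bd in auto)
  qed
  ultimately show ?thesis by blast
qed


text \<open>
  Uniform approximation suffices even though \<open>u\<close> need not be bounded, because \<open>u\<close> is integrable.
\<close>

lemma antiderivatives_orthogonal: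
  assumes u: "integrable (mu b) u" and orth: "\<And>h. smooth b h \<Longrightarrow> (\<integral>t. h t * u t \<partial>mu b) = 0"
    and x: "x \<in> antiderivatives b"
  shows "(\<integral>t. x t * u t \<partial>mu b) = 0"
proof -
  define A where "A = (\<integral>t. \<bar>u t\<bar> \<partial>mu b)"
  have A: "A \<ge> 0" by (simp add: A_def)
  have xr: "x \<in> regulated b" by (intro mean_zero_regulated antiderivatives_mean_zero x)
  have "\<bar>\<integral>t. x t * u t \<partial>mu b\<bar> \<le> 0 + e" if e: "e > 0" for e
  proof -
    from e A have "e / (A + 1) > 0" by simp
    from smooth_approximation[OF x this] obtain y where
      y: "smooth b y" "\<And>t. \<bar>y t - x t\<bar> \<le> e / (A + 1)" by blast
    have yr: "y \<in> regulated b" by (intro mean_zero_regulated smooth_mean_zero y)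
    have i: "integrable (mu b) (\<lambda>t. x t * u t)" "integrable (mu b) (\<lambda>t. y t * u t)"
      using xr yr u by (auto intro: regulated_times_integrable)
    have "(\<integral>t. x t * u t \<partial>mu b) = (\<integral>t. x t * u t - y t * u t \<partial>mu b)"
      using i orth[OF y(1)] by simp
    also have "\<bar>\<dots>\<bar> \<le> (\<integral>t. e / (A + 1) * \<bar>u t\<bar> \<partial>mu b)"
    proof (rule integral_abs_bound_integral)
      fix t
      have "\<bar>x t * u t - y t * u t\<bar> = \<bar>y t - x t\<bar> * \<bar>u t\<bar>"
        by (simp add: left_diff_distrib[symmetric] abs_mult abs_minus_commute)
      also have "\<dots> \<le> e / (A + 1) * \<bar>u t\<bar>" using y(2) by (intro mult_right_mono) auto
      finally show "\<bar>x t * u t - y t * u t\<bar> \<le> e / (A + 1) * \<bar>u t\<bar>" .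
    qed (use i u in auto)
    also have "\<dots> = e * (A / (A + 1))" by (simp add: A_def)
    also have "\<dots> \<le> e * 1" using e A by (intro mult_left_mono) (auto simp: divide_le_eq_1)
    finally show ?thesis by simp
  qed
  then have "\<bar>\<integral>t. x t * u t \<partial>mu b\<bar> \<le> 0" by (rule field_le_epsilon)
  then show ?thesis by simp
qed

text \<open>
  Let \<open>U\<close> be the primitive with mean zero of \<open>u\<close> minus its mean, and \<open>I\<close> the antiderivative of \<open>U\<close>. By
  integration by parts, the orthogonality of \<open>u\<close> to \<open>I\<close> says that the square of \<open>U\<close> has
  integral zero. So \<open>U\<close> vanishes, and \<open>u\<close> is almost everywhere equal to its mean.
\<close>

theorem du_Bois_Reymond:
  assumes u: "integrable (mu b) u" and orth: "\<And>h. smooth b h \<Longrightarrow> (\<integral>t. h t * u t \<partial>mu b) = 0"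
  shows "\<exists>c. AE t in mu b. u t = c"
proof -
  define c where "c = (\<integral>t. u t \<partial>mu b) / total_mass b"
  define v where "v t = u t - c" for t
  have v: "integrable (mu b) v" using u by (simp add: v_def[abs_def])
  have v0: "(\<integral>t. v t \<partial>mu b) = 0"
    using u total_mass_pos[of b] by (simp add: v_def[abs_def] c_def total_mass_def)
  from antiderivative_exists[OF v v0] obtain U where U: "U \<in> mean_zero (\<not> b)" "primitive b v U" by blast
  define I where "I = antiderivative (\<not> b) U"
  have I: "I \<in> antiderivatives b" "I \<in> mean_zero b" "primitive (\<not> b) U I"
    using U(1) antiderivative_mean_zero[OF U(1)] primitive_antiderivative[OF U(1)]
    by (auto simp: I_def antiderivatives_def)
  have "(\<integral>t. I t * v t \<partial>mu b) = (\<integral>t. I t * u t - c * I t \<partial>mu b)"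
    by (simp add: v_def right_diff_distrib mult.commute)
  also have "\<dots> = 0"
    using antiderivatives_orthogonal[OF u orth I(1)] mean_zero_integral[OF I(2)] mean_zero_integrable[OF I(2)]
      regulated_times_integrable[OF mean_zero_regulated[OF I(2)] u] by simp
  finally have Iv: "(\<integral>t. I t * v t \<partial>mu b) = 0" .
  have "(\<integral>t. U t * U t \<partial>mu (\<not> b)) = - (\<integral>t. v t * I t \<partial>mu b)"
    by (rule integration_by_parts[OF U(2) v I(3) mean_zero_integrable[OF U(1)]])
  with Iv have "(\<integral>t. U t * U t \<partial>mu (\<not> b)) = 0" by (simp add: mult.commute)
  moreover have "integrable (mu (\<not> b)) (\<lambda>t. U t * U t)"
    by (rule regulated_times_integrable[OF mean_zero_regulated[OF U(1)] mean_zero_integrable[OF U(1)]])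
  ultimately have "AE t in mu (\<not> b). U t * U t = 0"
    by (subst (asm) integral_nonneg_eq_0_iff_AE) auto
  then have "AE t in mu (\<not> b). U t = 0" by simp
  from regulated_zero_if_AE[OF mean_zero_regulated[OF U(1)] this] have "U = (\<lambda>_. 0)" by auto
  with U(2) have "primitive b v (\<lambda>_. 0)" by simp
  from AE_zero_if_primitive_const[OF v this] have "AE t in mu b. u t = c" by (simp add: v_def)
  then show ?thesis ..
qed

section \<open>Strong derivatives of every order\<close>

definition D_strong :: "bool \<Rightarrow> (real \<Rightarrow> real) \<Rightarrow> real \<Rightarrow> real" where
  "D_strong b f = (if b then D_minus W f else D_plus V f)"

definition D_strong_exists :: "bool \<Rightarrow> (real \<Rightarrow> real) \<Rightarrow> bool" where
  "D_strong_exists b f \<longleftrightarrow> (if b then D_minus_exists W f else D_plus_exists V f)"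

lemma strong_deriv_D_strong:
  assumes "strong_deriv b f F"
  shows "D_strong_exists b f" "D_strong b f = F"
proof -
  show "D_strong_exists b f"
    using assms by (auto simp: strong_deriv_def D_strong_exists_def D_minus_exists_def D_plus_exists_def split: if_splits)
  show "D_strong b f = F"
    using assms by (auto simp: strong_deriv_def D_strong_def D_minus_def D_plus_def fun_eq_iff intro!: tendsto_Lim split: if_splits)
qed

lemma D_strong_exists_strong_deriv:
  assumes "D_strong_exists b f"
  shows "strong_deriv b f (D_strong b f)"
proof -
  have L: "(g \<longlongrightarrow> Lim F g) F" if "\<exists>l. (g \<longlongrightarrow> l) F" "F \<noteq> bot"
    for g :: "real \<Rightarrow> real" and F :: "real filter"
    using that tendsto_Lim[of F g] by auto
  show ?thesis
    using assms unfolding strong_deriv_def D_strong_exists_def D_minus_exists_def D_plus_exists_def D_strong_def D_minus_def D_plus_def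
    by (auto split: if_splits intro!: L)
qed

primrec D_iter :: "bool \<Rightarrow> nat \<Rightarrow> (real \<Rightarrow> real) \<Rightarrow> real \<Rightarrow> real" where
  "D_iter b 0 f = f"
| "D_iter b (Suc n) f = D_strong (side b (Suc n)) (D_iter b n f)"

lemma D_WV_eq: "D_WV W V n f = D_iter False n f"
  by (induction n) (auto simp: D_strong_def side_def)

lemma D_VW_eq: "D_VW V W n f = D_iter True n f"
  by (induction n) (auto simp: D_strong_def side_def)

lemma mean_zero_eq: "mean_zero b = (if b then C1_torus W else C0_torus V)"
  by (auto simp: mean_zero_def regulated_def C1_torus_def C0_torus_def mu_def)

definition Cinf0 :: "bool \<Rightarrow> (real \<Rightarrow> real) set" where
  "Cinf0 b = {f \<in> mean_zero b. \<forall>n. D_strong_exists (side b (Suc n)) (D_iter b n f) \<and>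
     D_iter b (Suc n) f \<in> mean_zero (side b (Suc n))}"

lemma Cinf0_WV_eq: "Cinf0_WV W V = Cinf0 False"
  unfolding Cinf0_WV_def Cinf0_def D_WV_eq mean_zero_eq D_strong_exists_def side_def
  by (auto simp del: D_iter.simps)

lemma Cinf0_VW_eq: "Cinf0_VW V W = Cinf0 True"
  unfolding Cinf0_VW_def Cinf0_def D_VW_eq mean_zero_eq D_strong_exists_def side_def
  by (auto simp del: D_iter.simps)

text \<open>
  The fundamental theorem, applied at every level, in both directions.
\<close>

lemma Cinf0_iff_smooth: "f \<in> Cinf0 b \<longleftrightarrow> smooth b f"
proof
  assume f: "f \<in> Cinf0 b"
  have m: "D_iter b n f \<in> mean_zero (side b n)" for n
    using f unfolding Cinf0_def by (cases n) auto
  have "smooth_chain b (\<lambda>n. D_iter b n f)"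
    unfolding smooth_chain_def
  proof (intro allI conjI m)
    fix n
    have "strong_deriv (side b (Suc n)) (D_iter b n f) (D_iter b (Suc n) f)"
      using f D_strong_exists_strong_deriv unfolding Cinf0_def by simp
    moreover have "D_iter b n f \<in> regulated (\<not> side b (Suc n))"
      using mean_zero_regulated[OF m[of n]] by (simp add: side_Suc)
    ultimately show "primitive (side b (Suc n)) (D_iter b (Suc n) f) (D_iter b n f)"
      using mean_zero_regulated[OF m[of "Suc n"]] by (intro primitive_if_strong_deriv)
  qed
  then show "smooth b f" unfolding smooth_def by (auto intro!: exI[of _ "\<lambda>n. D_iter b n f"])
next
  assume "smooth b f"
  then obtain y where y: "smooth_chain b y" "y 0 = f" unfolding smooth_def by blast
  have ym: "y n \<in> mean_zero (side b n)" and yp: "primitive (side b (Suc n)) (y (Suc n)) (y n)" for n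
    using y(1) unfolding smooth_chain_def by blast+
  have sd: "strong_deriv (side b (Suc n)) (y n) (y (Suc n))" for n
    by (rule strong_deriv_if_primitive[OF yp mean_zero_regulated[OF ym]])
  have eq: "D_iter b n f = y n" for n
    by (induction n) (use y(2) strong_deriv_D_strong(2)[OF sd] in auto)
  show "f \<in> Cinf0 b"
    using ym[of 0] ym y(2) strong_deriv_D_strong(1)[OF sd] by (simp add: Cinf0_def eq del: D_iter.simps)
qed

section \<open>Weak derivatives\<close>

lemma L2_integrable:
  assumes "f \<in> L2_torus (mu b)"
  shows "integrable (mu b) f"
proof -
  have "integrable (mu b) (\<lambda>x. 1 + (f x)\<^sup>2)" using assms by (simp add: L2_torus_def)
  moreover have "f \<in> borel_measurable (mu b)" using assms by (simp add: L2_torus_def borel_measurable_mu)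
  moreover have "\<bar>y\<bar> \<le> 1 + y\<^sup>2" for y :: real
  proof -
    have "0 \<le> y\<^sup>2 - 2 * \<bar>y\<bar> + 1" using zero_le_power2[of "\<bar>y\<bar> - 1"] by (simp add: power2_diff)
    with zero_le_power2[of y] show ?thesis by linarith
  qed
  ultimately show ?thesis
    by (elim Bochner_Integration.integrable_bound) auto
qed

lemma regulated_L2: "f \<in> regulated b \<Longrightarrow> f \<in> L2_torus (mu c)"
  using regulated_times_integrable[OF _ regulated_integrable, of f b f b c]
  by (simp add: L2_torus_def regulated_periodic regulated_borel power2_eq_square)

text \<open>
  The weak derivative with \<open>g\<close> tested in pairs: a smooth function \<open>g\<close> with mean zero and its
  derivative \<open>G\<close>. Testing with constants is the condition that \<open>F\<close> has mean zero.
\<close>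

definition weak_deriv :: "bool \<Rightarrow> (real \<Rightarrow> real) \<Rightarrow> (real \<Rightarrow> real) \<Rightarrow> bool" where
  "weak_deriv b f F \<longleftrightarrow> f \<in> L2_torus (mu (\<not> b)) \<and> F \<in> L2_torus (mu b) \<and> (\<integral>x. F x \<partial>mu b) = 0 \<and>
    (\<forall>g G. smooth b g \<longrightarrow> smooth (\<not> b) G \<longrightarrow> primitive (\<not> b) G g \<longrightarrow>
      (\<integral>x. f x * G x \<partial>mu (\<not> b)) = - (\<integral>x. F x * g x \<partial>mu b))"

lemma smooth_zero: "smooth b (\<lambda>_. 0)"
  unfolding smooth_def smooth_chain_def
  by (intro exI[of _ "\<lambda>_ _. 0"]) (simp add: mean_zero_def regulated_const primitive_zero)

text \<open>
  The derivative of the head of a chain is the next member, and the rest is again a chain.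
\<close>

lemma smooth_derivative:
  assumes "smooth b g"
  obtains G where "smooth (\<not> b) G" "primitive (\<not> b) G g"
proof -
  from assms obtain y where y: "smooth_chain b y" "y 0 = g" unfolding smooth_def by blast
  have "y (Suc n) \<in> mean_zero (side b (Suc n)) \<and>
      primitive (side b (Suc (Suc n))) (y (Suc (Suc n))) (y (Suc n))" for n
    using y(1) unfolding smooth_chain_def by blast
  then have "smooth_chain (\<not> b) (\<lambda>n. y (Suc n))"
    by (simp add: smooth_chain_def side_Not side_Suc)
  then have "smooth (\<not> b) (y 1)" unfolding smooth_def by auto
  moreover have "primitive (side b (Suc 0)) (y (Suc 0)) (y 0)" using y(1) unfolding smooth_chain_def by blast
  then have "primitive (\<not> b) (y 1) g" using y(2) by (simp add: side_Suc)
  ultimately show ?thesis by (rule that)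
qed

lemma D_strong_add_const: "D_strong b (\<lambda>x. c + g x) = D_strong b g"
proof -
  have "diff_quot U (\<lambda>x. c + g x) x = diff_quot U g x" for U x
    by (simp add: diff_quot_def fun_eq_iff)
  then show ?thesis by (simp add: D_strong_def D_minus_def[abs_def] D_plus_def[abs_def])
qed

lemma weak_deriv_iff:
  "weak_deriv b f F \<longleftrightarrow> f \<in> L2_torus (mu (\<not> b)) \<and> F \<in> L2_torus (mu b) \<and>
    (\<forall>g\<in>{(\<lambda>x. c + g x) | c g. g \<in> Cinf0 b}.
      (\<integral>x. f x * D_strong (\<not> b) g x \<partial>mu (\<not> b)) = - (\<integral>x. F x * g x \<partial>mu b))"
    (is "_ \<longleftrightarrow> ?L2f \<and> ?L2F \<and> ?weak")
proof (cases "?L2f \<and> ?L2F")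
  case True
  then have iF: "integrable (mu b) F" by (simp add: L2_integrable)
  have D: "D_strong (\<not> b) g = G" if "smooth (\<not> b) G" "primitive (\<not> b) G g" for g G
    using strong_deriv_D_strong(2)[OF strong_deriv_if_primitive[OF that(2) mean_zero_regulated[OF smooth_mean_zero[OF that(1)]]]] .
  have "weak_deriv b f F \<longleftrightarrow> ?weak"
  proof
    assume w: "weak_deriv b f F"
    show ?weak
    proof safe
      fix c g assume "g \<in> Cinf0 b"
      then have g: "smooth b g" by (simp add: Cinf0_iff_smooth)
      from smooth_derivative[OF g] obtain G where G: "smooth (\<not> b) G" "primitive (\<not> b) G g" .
      have ig: "integrable (mu b) (\<lambda>x. F x * g x)"
        using regulated_times_integrable[OF mean_zero_regulated[OF smooth_mean_zero[OF g]] iF] by (simp add: mult.commute)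
      have "(\<integral>x. F x * (c + g x) \<partial>mu b) = (\<integral>x. F x * c + F x * g x \<partial>mu b)"
        by (simp add: distrib_left)
      also have "\<dots> = (\<integral>x. F x * g x \<partial>mu b)"
        using iF ig w by (simp add: weak_deriv_def)
      finally show "(\<integral>x. f x * D_strong (\<not> b) (\<lambda>x. c + g x) x \<partial>mu (\<not> b)) = - (\<integral>x. F x * (c + g x) \<partial>mu b)"
        using w g G unfolding D_strong_add_const D[OF G] weak_deriv_def by simp
    qed
  next
    assume w: ?weak
    have z: "smooth b (\<lambda>_. 0)" "smooth (\<not> b) (\<lambda>_. 0)" by (rule smooth_zero)+
    have "(\<lambda>x. 1 + 0) \<in> {(\<lambda>x. c + g x) | c g. g \<in> Cinf0 b}"
      using z(1) by (intro CollectI exI[of _ 1] exI[of _ "\<lambda>_. 0"]) (simp add: Cinf0_iff_smooth)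
    from w[rule_format, OF this] have "(\<integral>x. F x \<partial>mu b) = 0"
      unfolding D_strong_add_const D[OF z(2) primitive_zero] by simp
    moreover have "(\<integral>x. f x * G x \<partial>mu (\<not> b)) = - (\<integral>x. F x * g x \<partial>mu b)"
      if "smooth b g" "smooth (\<not> b) G" "primitive (\<not> b) G g" for g G
    proof -
      have "(\<lambda>x. 0 + g x) \<in> {(\<lambda>x. c + g x) | c g. g \<in> Cinf0 b}"
        using that(1) by (intro CollectI exI[of _ 0] exI[of _ g]) (simp add: Cinf0_iff_smooth)
      from w[rule_format, OF this] show ?thesis unfolding D_strong_add_const D[OF that(2,3)] by simp
    qed
    ultimately show "weak_deriv b f F" using True unfolding weak_deriv_def by blast
  qed
  with True show ?thesis by blast
qed (auto simp: weak_deriv_def)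

lemma weak_D_minus_eq: "weak_D_minus W V f F \<longleftrightarrow> weak_deriv True f F"
  unfolding weak_deriv_iff weak_D_minus_def Cinf_VW_def Cinf0_VW_eq by (simp add: mu_def D_strong_def)

lemma weak_D_plus_eq: "weak_D_plus W V f F \<longleftrightarrow> weak_deriv False f F"
  unfolding weak_deriv_iff weak_D_plus_def Cinf_WV_def Cinf0_WV_eq by (simp add: mu_def D_strong_def)

lemma primitive_weak_deriv:
  assumes "primitive b F f" "F \<in> regulated b"
  shows "weak_deriv b f F"
proof -
  have iF: "integrable (mu b) F" using assms by (intro regulated_integrable)
  have f: "f \<in> regulated (\<not> b)" by (rule primitive_regulated[OF assms(1) iF])
  show ?thesis
    unfolding weak_deriv_def
    using regulated_L2[OF f] regulated_L2[OF assms(2)] primitive_integral_zero[OF assms(1)]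
      integration_by_parts[OF assms(1) iF] smooth_mean_zero mean_zero_integrable by blast
qed

lemma weak_deriv_cong_AE:
  assumes w: "weak_deriv b f F" and f': "f' \<in> L2_torus (mu (\<not> b))" and ae: "AE x in mu (\<not> b). f x = f' x"
  shows "weak_deriv b f' F"
proof -
  have m: "f \<in> borel_measurable (mu (\<not> b))" "f' \<in> borel_measurable (mu (\<not> b))"
    using w f' by (simp_all add: weak_deriv_def L2_torus_def borel_measurable_mu)
  have "(\<integral>x. f x * G x \<partial>mu (\<not> b)) = (\<integral>x. f' x * G x \<partial>mu (\<not> b))" if "smooth (\<not> b) G" for G
  proof (rule integral_cong_AE)
    have "G \<in> borel_measurable (mu (\<not> b))"
      using that by (intro borel_measurable_mu regulated_borel mean_zero_regulated smooth_mean_zero)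
    with m show "(\<lambda>x. f x * G x) \<in> borel_measurable (mu (\<not> b))" "(\<lambda>x. f' x * G x) \<in> borel_measurable (mu (\<not> b))"
      by simp_all
    show "AE x in mu (\<not> b). f x * G x = f' x * G x" using ae by eventually_elim simp
  qed
  then show ?thesis using w f' unfolding weak_deriv_def by simp
qed

text \<open>
  The difference is orthogonal to all smooth functions with mean zero, hence constant, and a
  constant with mean zero is zero.
\<close>

lemma weak_deriv_unique_AE:
  assumes "weak_deriv b f F" "weak_deriv b f G"
  shows "AE x in mu b. F x = G x"
proof -
  have i: "integrable (mu b) F" "integrable (mu b) G"
    using assms by (auto simp: weak_deriv_def intro: L2_integrable)
  have "\<exists>c. AE x in mu b. F x - G x = c"
  proof (rule du_Bois_Reymond)
    show "integrable (mu b) (\<lambda>x. F x - G x)" using i by simp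
    fix h assume h: "smooth b h"
    from smooth_derivative[OF h] obtain H where H: "smooth (\<not> b) H" "primitive (\<not> b) H h" .
    have hr: "h \<in> regulated b" by (intro mean_zero_regulated smooth_mean_zero h)
    have "(\<integral>x. f x * H x \<partial>mu (\<not> b)) = - (\<integral>x. F x * h x \<partial>mu b)"
      "(\<integral>x. f x * H x \<partial>mu (\<not> b)) = - (\<integral>x. G x * h x \<partial>mu b)"
      using assms h H unfolding weak_deriv_def by blast+
    then have "(\<integral>x. F x * h x \<partial>mu b) = (\<integral>x. G x * h x \<partial>mu b)" by simp
    then show "(\<integral>x. h x * (F x - G x) \<partial>mu b) = 0"
      using regulated_times_integrable[OF hr i(1)] regulated_times_integrable[OF hr i(2)]
      by (simp add: right_diff_distrib mult.commute)
  qed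
  then obtain c where c: "AE x in mu b. F x - G x = c" by blast
  have "(\<integral>x. F x - G x \<partial>mu b) = (\<integral>x. c \<partial>mu b)"
    using c i by (intro integral_cong_AE) auto
  moreover have "(\<integral>x. F x - G x \<partial>mu b) = 0"
    using assms i by (simp add: weak_deriv_def)
  ultimately have "c = 0" using total_mass_pos[of b] by (simp add: total_mass_def)
  with c show ?thesis by simp
qed

text \<open>
  Let \<open>p\<close> be a primitive of \<open>F\<close>. By integration by parts \<open>f - p\<close> is orthogonal to the derivatives \<open>G\<close> of
  smooth functions. Every smooth \<open>G\<close> with mean zero is such a derivative, so \<open>f - p\<close> is constant
  almost everywhere.
\<close>

lemma weak_deriv_primitive:
  assumes w: "weak_deriv b f F"
  shows "\<exists>f'. primitive b F f' \<and> (AE x in mu (\<not> b). f x = f' x)"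
proof -
  have iF: "integrable (mu b) F" and i: "integrable (mu (\<not> b)) f" and F0: "(\<integral>x. F x \<partial>mu b) = 0"
    using w by (auto simp: weak_deriv_def intro: L2_integrable)
  from antiderivative_exists[OF iF F0] obtain p where p: "p \<in> mean_zero (\<not> b)" "primitive b F p" by blast
  have ip: "integrable (mu (\<not> b)) p" by (rule mean_zero_integrable[OF p(1)])
  have "\<exists>c. AE x in mu (\<not> b). f x - p x = c"
  proof (rule du_Bois_Reymond)
    show "integrable (mu (\<not> b)) (\<lambda>x. f x - p x)" using i ip by simp
    fix G assume G: "smooth (\<not> b) G"
    define g where "g = antiderivative (\<not> b) G"
    have Gm: "G \<in> mean_zero (\<not> b)" by (rule smooth_mean_zero[OF G])
    have g: "smooth b g" "primitive (\<not> b) G g"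
      using smooth_antiderivative[OF G] primitive_antiderivative[OF Gm] by (simp_all add: g_def)
    have "(\<integral>x. f x * G x \<partial>mu (\<not> b)) = - (\<integral>x. F x * g x \<partial>mu b)"
      using w G g unfolding weak_deriv_def by blast
    also have "\<dots> = (\<integral>x. p x * G x \<partial>mu (\<not> b))"
      using integration_by_parts[OF p(2) iF g(2) mean_zero_integrable[OF Gm]] by simp
    finally show "(\<integral>x. G x * (f x - p x) \<partial>mu (\<not> b)) = 0"
      using regulated_times_integrable[OF mean_zero_regulated[OF Gm] i] regulated_times_integrable[OF mean_zero_regulated[OF Gm] ip]
      by (simp add: right_diff_distrib mult.commute)
  qed
  then obtain c where "AE x in mu (\<not> b). f x - p x = c" by blast
  then have "AE x in mu (\<not> b). f x = p x - - c" by eventually_elim simp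
  with primitive_diff_const[OF p(2), of "- c"] show ?thesis by blast
qed

section \<open>Sobolev functions of infinite order\<close>

lemma not_side_Suc: "(\<not> side b (Suc n)) = side b n"
  by (simp add: side_Suc)

lemma weak_D_WV_Suc:
  "weak_D_WV W V (Suc n) f F \<longleftrightarrow> (\<exists>G. weak_D_WV W V n f G \<and> weak_deriv (side False (Suc n)) G F)"
  by (simp add: weak_D_minus_eq weak_D_plus_eq side_def)

text \<open>
  A different chain of weak derivatives may be given for every order. Uniqueness makes it possible to
  merge these chains into a single sequence.
\<close>

lemma weak_D_WV_unique_AE:
  assumes "f \<in> L2_torus (mu False)" "weak_D_WV W V n f F" "weak_D_WV W V n f G"
  shows "F \<in> L2_torus (mu (side False n)) \<and> (AE x in mu (side False n). F x = G x)"
  using assms(2,3)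
proof (induction n arbitrary: F G)
  case 0
  then show ?case using assms(1) by simp
next
  case (Suc n)
  from Suc.prems obtain F' G' where
    F': "weak_D_WV W V n f F'" "weak_deriv (side False (Suc n)) F' F" and
    G': "weak_D_WV W V n f G'" "weak_deriv (side False (Suc n)) G' G"
    unfolding weak_D_WV_Suc by blast
  from Suc.IH[OF G'(1) F'(1)] have ae: "AE x in mu (\<not> side False (Suc n)). G' x = F' x"
    unfolding not_side_Suc by blast
  have "F' \<in> L2_torus (mu (\<not> side False (Suc n)))" using F'(2) by (simp add: weak_deriv_def)
  from weak_deriv_cong_AE[OF G'(2) this ae] F'(2) show ?case
    using weak_deriv_unique_AE by (auto simp: weak_deriv_def)
qed

text \<open>
  Each weak derivative of \<open>f\<close> has a representative \<open>y n\<close> that is a primitive of the next weak derivative,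
  hence also of the next representative. The sequence \<open>y\<close> becomes a smooth chain once the mean of
  \<open>y 0\<close> is subtracted; the later members have mean zero because they have periodic primitives.
\<close>

lemma Hinf_imp_smooth:
  assumes "f \<in> Hinf_WV W V"
  shows "\<exists>c g. smooth False g \<and> (AE x in mu False. f x = c + g x)"
proof -
  have f2: "f \<in> L2_torus (mu False)" and ex: "\<exists>F. weak_D_WV W V n f F" for n
  proof -
    have k: "f \<in> H_WV k W V" if "k \<ge> 1" for k using assms that by (auto simp: Hinf_WV_def)
    from k[of 1] show "f \<in> L2_torus (mu False)" by (simp add: H_WV_def mu_def)
    show "\<exists>F. weak_D_WV W V n f F"
    proof (cases n)
      case (Suc m)
      with k[of n] show ?thesis by (auto simp: H_WV_def simp del: weak_D_WV.simps)
    qed simp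
  qed
  from ex obtain Fs where Fs: "\<And>n. weak_D_WV W V n f (Fs n)" by metis
  have F0: "Fs 0 = f" using Fs[of 0] by simp
  have L2: "Fs n \<in> L2_torus (mu (side False n))" for n
    using weak_D_WV_unique_AE[OF f2 Fs[of n] Fs[of n]] by blast
  have w: "weak_deriv (side False (Suc n)) (Fs n) (Fs (Suc n))" for n
  proof -
    from Fs[of "Suc n"] obtain G where G: "weak_D_WV W V n f G" "weak_deriv (side False (Suc n)) G (Fs (Suc n))"
      unfolding weak_D_WV_Suc by blast
    from weak_D_WV_unique_AE[OF f2 G(1) Fs[of n]] L2[of n] show ?thesis
      by (intro weak_deriv_cong_AE[OF G(2)]) (simp_all only: not_side_Suc)
  qed
  have "\<exists>y. primitive (side False (Suc n)) (Fs (Suc n)) y \<and> (AE x in mu (side False n). Fs n x = y x)" for n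
    using weak_deriv_primitive[OF w[of n]] unfolding not_side_Suc .
  then obtain y where y: "\<And>n. primitive (side False (Suc n)) (Fs (Suc n)) (y n)"
    "\<And>n. AE x in mu (side False n). Fs n x = y n x" by metis
  have yr: "y n \<in> regulated (side False n)" for n
    using primitive_regulated[OF y(1) L2_integrable[OF L2]] by (simp add: side_Suc)
  have m: "Fs n \<in> borel_measurable (mu (side False n))" "y n \<in> borel_measurable (mu (side False n))" for n
    using L2_integrable[OF L2[of n]] borel_measurable_mu[OF regulated_borel[OF yr[of n]]] by auto
  have yp: "primitive (side False (Suc n)) (y (Suc n)) (y n)" for n
    by (rule primitive_cong_AE[OF y(2) m y(1)])
  have ym: "y (Suc n) \<in> mean_zero (side False (Suc n))" for n
    using yr primitive_integral_zero[OF yp] by (simp add: mean_zero_def)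
  define c where "c = (\<integral>x. y 0 x \<partial>mu False) / total_mass False"
  define z where "z n = (case n of 0 \<Rightarrow> (\<lambda>x. y 0 x - c) | Suc m \<Rightarrow> y (Suc m))" for n
  have "smooth_chain False z"
    unfolding smooth_chain_def
  proof
    fix n
    show "z n \<in> mean_zero (side False n) \<and> primitive (side False (Suc n)) (z (Suc n)) (z n)"
    proof (cases n)
      case 0
      have "y 0 \<in> regulated False" using yr[of 0] by simp
      from diff_mean_in_mean_zero[OF this] primitive_diff_const[OF yp[of 0], of c] 0
      show ?thesis by (simp add: z_def c_def)
    next
      case (Suc m)
      then show ?thesis using ym[of m] yp[of n] by (simp add: z_def)
    qed
  qed
  then have "smooth False (z 0)" unfolding smooth_def by blast
  moreover have "AE x in mu False. f x = c + z 0 x"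
    using y(2)[of 0] unfolding side_0 F0 by (simp add: z_def)
  ultimately show ?thesis by blast
qed

lemma smooth_imp_Hinf:
  assumes "smooth False g"
  shows "(\<lambda>x. c + g x) \<in> Hinf_WV W V"
proof -
  from assms obtain y where y: "smooth_chain False y" "y 0 = g" unfolding smooth_def by blast
  have ym: "y n \<in> mean_zero (side False n)" and yp: "primitive (side False (Suc n)) (y (Suc n)) (y n)" for n
    using y(1) unfolding smooth_chain_def by blast+
  define z where "z n = (case n of 0 \<Rightarrow> (\<lambda>x. c + y 0 x) | Suc m \<Rightarrow> y (Suc m))" for n
  have zp: "primitive (side False (Suc n)) (z (Suc n)) (z n)" for n
  proof (cases n)
    case 0
    with primitive_diff_const[OF yp[of 0], of "- c"] show ?thesis by (simp add: z_def add.commute)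
  next
    case (Suc m)
    then show ?thesis using yp[of n] by (simp add: z_def)
  qed
  have weak: "weak_D_WV W V n (z 0) (z n)" for n
  proof (induction n)
    case (Suc n)
    have "z (Suc n) \<in> regulated (side False (Suc n))" using mean_zero_regulated[OF ym] by (simp add: z_def)
    from primitive_weak_deriv[OF zp this] Suc show ?case unfolding weak_D_WV_Suc by blast
  qed simp
  have "weak_deriv (side False (Suc 0)) (z 0) (z (Suc 0))"
    using mean_zero_regulated[OF ym[of "Suc 0"]] by (intro primitive_weak_deriv zp) (simp add: z_def)
  then have "z 0 \<in> L2_torus (mu False)" by (simp add: weak_deriv_def side_Suc)
  then have "z 0 \<in> Hinf_WV W V"
    using weak by (auto simp: Hinf_WV_def H_WV_def mu_def)
  then show ?thesis using y(2) by (simp add: z_def)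
qed

theorem Hinf_quotient_eq_Cinf_quotient:
  "Hinf_WV W V // ae_equal_L2 (dV_torus V) = Cinf_WV W V // ae_equal_L2 (dV_torus V)"
proof -
  let ?r = "ae_equal_L2 (dV_torus V)"
  have sub: "Cinf_WV W V \<subseteq> Hinf_WV W V"
    unfolding Cinf_WV_def Cinf0_WV_eq by (auto simp: Cinf0_iff_smooth intro: smooth_imp_Hinf)
  have L2: "f \<in> L2_torus (dV_torus V)" if "f \<in> Hinf_WV W V" for f
    using that by (auto simp: Hinf_WV_def H_WV_def)
  have cls: "\<exists>g\<in>Cinf_WV W V. ?r `` {f} = ?r `` {g}" if f: "f \<in> Hinf_WV W V" for f
  proof -
    from Hinf_imp_smooth[OF f] obtain c g where g: "smooth False g" "AE x in dV_torus V. f x = c + g x"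
      unfolding mu_False by blast
    let ?g = "\<lambda>x. c + g x"
    have gC: "?g \<in> Cinf_WV W V"
      using g(1) unfolding Cinf_WV_def Cinf0_WV_eq Cinf0_iff_smooth[symmetric] by blast
    have "(AE x in dV_torus V. f x = h x) \<longleftrightarrow> (AE x in dV_torus V. ?g x = h x)" for h
    proof
      assume "AE x in dV_torus V. f x = h x"
      with g(2) show "AE x in dV_torus V. ?g x = h x" by eventually_elim simp
    next
      assume "AE x in dV_torus V. ?g x = h x"
      with g(2) show "AE x in dV_torus V. f x = h x" by eventually_elim simp
    qed
    then have "?r `` {f} = ?r `` {?g}"
      using L2[OF f] L2[OF subsetD[OF sub gC]] by (auto simp: ae_equal_L2_def)
    with gC show ?thesis by blast
  qed
  show ?thesis
  proof (rule equalityI)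
    show "Hinf_WV W V // ?r \<subseteq> Cinf_WV W V // ?r"
    proof
      fix X assume "X \<in> Hinf_WV W V // ?r"
      then obtain f where "f \<in> Hinf_WV W V" "X = ?r `` {f}" by (rule quotientE)
      with cls obtain g where "g \<in> Cinf_WV W V" "X = ?r `` {g}" by blast
      then show "X \<in> Cinf_WV W V // ?r" by (simp add: quotientI)
    qed
    show "Cinf_WV W V // ?r \<subseteq> Hinf_WV W V // ?r"
      using sub by (auto simp: quotient_def)
  qed
qed

end

theorem corollary26:
  fixes W V :: "real \<Rightarrow> real"
  assumes "strict_mono W" and "strict_mono V"
    and "cadlag W" and "caglad V"
    and "\<And>x. W (x + 1) - W x = W 1 - W 0"
    and "\<And>x. V (x + 1) - V x = V 1 - V 0"
    and "isCont W 0" and "isCont V 0"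
    and "W 0 = 0" and "V 0 = 0"
  shows "Hinf_WV W V // ae_equal_L2 (dV_torus V) = Cinf_WV W V // ae_equal_L2 (dV_torus V)"
proof -
  interpret torus_pair W V by standard fact+
  show ?thesis by (rule Hinf_quotient_eq_Cinf_quotient)
qed

end
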